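(* Let $x_0\in\mathbb{R}$, $c\in\mathcal{C}(x_0)$, $t_p=t_p(x_0,c)$, $t_*=t_*(x_0,c)$, and write $x_p=x_0+t_pf'(c)$ if $t_p<\infty$, $x_*=x_0+t_*f'(c)$ if $t_*<\infty$. Then the characteristic $L_c(x_0)$ emitting from the point $x_0$ on the $x$-axis must be one of the following four cases: (i) For $t_*=t_p\in(0,\infty)$ with $\{c\}=\mathcal{U}(x_p,t_p)$, the characteristic $L_c(x_0)$ terminates at $(x_p,t_p)$ only due to the compression of local characteristics near $x_0$, and $(x_p,t_p)$ is a continuous shock generation point. (ii) For $t_*=t_p\in(0,\infty)$ with $\{c\}\subsetneqq\mathcal{U}(x_p,t_p)$, the characteristic $L_c(x_0)$ terminates at $(x_p,t_p)$ due to the combination of the compression of local characteristics near $x_0$ (in part) with some characteristics away from $x_0$, and $(x_p,t_p)$ is a discontinuous shock generation point or a point of shocks. (iii) For $t_*<t_p\in(0,\infty]$, the characteristic $L_c(x_0)$ terminates at $(x_*,t_* )$ due to the collision of $L_c(x_0)$ with some characteristics away from $x_0$, and $(x_*,t_* )$ is a point of a shock. (iv) For $t_*=t_p=\infty$, the characteristic $L_c(x_0)$ exists for all time.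
   Context: Setting: $f\in C^2(\mathbb{R})$, $f''\ge0$, $\mathcal{L}\{f''=0\}=0$ ($\mathcal L$ Lebesgue measure), so $f'$ is strictly increasing; $\varphi\in L^\infty(\mathbb{R})$. For $t>0$: $E(u;x,t)=t\int_0^u f''(s)(\varphi(x-tf'(s))-s)\,ds$; $\mathcal{U}(x,t)$ is the (nonempty compact) set of maximizers of $E(\cdot\,;x,t)$. The entropy solution of $u_t+f(u)_x=0$, $u|_{t=0}=\varphi$ is $u(x,t)=\inf\mathcal{U}(x,t)$, with traces $u(x-,t)=\sup\mathcal{U}(x,t)$, $u(x+,t)=\inf\mathcal{U}(x,t)$. $L_c(x_0)=\{(x,t): x=x_0+tf'(c),\ t>0\}$; $\mathcal{C}(x_0)=\{c: c\in\mathcal{U}(x,t)\text{ for some }(x,t)\in L_c(x_0)\}$; $L_c(x_0)$ is called a characteristic emitting from $x_0$ if $c\in\mathcal{C}(x_0)$. For $c\in\mathcal{C}(x_0)$: lifespan $t_*(x_0,c)=\sup\{t>0: c\in\mathcal{U}(x_0+tf'(c),t)\}$; upper bound of lifespan $t_p=\min\{t_p^+,t_p^-\}$ with $t_p^\pm=\sup\{t>0: \Phi(l;x_0,c)>F(l;t,c)\text{ for all sufficiently small }\pm l>0\}$, where $\Phi(l;x_0,c)=\int_{x_0}^{x_0+l}(\varphi-c)\,d\xi$, $F(l;t,c)=-t\int_c^{u(l;t,c)}(s-c)f''(s)\,ds$, $u(l;t,c)=(f')^{-1}(f'(c)-l/t)$. One always has $0<t_*\le t_p\le\infty$. "$L_c(x_0)$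 terminates at its point with time $t'$" means $\mathcal{U}(x,t)=\{c\}$ at its points with $t<t'$ and $c\notin\mathcal{U}(x,t)$ at its points with $t>t'$; "exists for all time" means $\mathcal{U}(x,t)=\{c\}$ on all of $L_c(x_0)$. The causes of termination ("compression of local characteristics near $x_0$", "collision with characteristics away from $x_0$") are descriptive: $c\in\mathcal U(x,t)$ at the point $(x,t)$ of $L_c(x_0)$ exactly when $\Phi(l;x_0,c)\ge F(l;t,c)$ for all $l$ of the form $t(f'(c)-f'(u))$, $u\in\mathbb R$; $t_p$ involves only arbitrarily small $l$, i.e. data near $x_0$, whereas $t_*$ involves all $l$, and an element of $\mathcal U(x,t)$ different from $c$ gives a shock-free backward characteristic reaching the $x$-axis at a point other than $x_0$. Restart at time $\tau>0$: for $t>\tau$, $E(v;x,t;\tau)=(t-\tau)\int_0^vf''(s)\big(u(x-(t-\tau)f'(s),\tau)-s\big)\,ds$, $\mathcal{U}(x,t;\tau)$ its set of maximizers in $v$, and $\mathcal{C}_\tau(x)=\{c: c\in\mathcal{U}(x+(t-\tau)f'(c),t;\tau)\text{ for some }t>\tau\}$. A point $(x,t)$ with $t>0$ is: a continuous shock generation point if $u(x-,t)=u(x+,t)$ and $\mathcal{C}_t(x)=\varnothing$ (so $u$ is continuous there and a shock emits from it); a discontinuous shock generation point if $u(x-,t)>u(x+,t)$ and $\mathcal{U}(x,t)=[u(x+,t),u(x-,t)]$; a point of shocks if $u(x-,t)>u(x+,t)$ and $\mathcal{U}(x,t)\subsetneqq[u(x+,t),u(x-,t)]$; in (iii), the paper's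 argument for "point of a shock" is that $\{c\}\subsetneqq\mathcal{U}(x_*,t_* )$, i.e. $u$ is discontinuous at $(x_*,t_* )$. *)

theory Defs
  imports "HOL-Analysis.Analysis"
begin

text \<open>
  The flux \<open>f\<close> and the initial datum \<open>\<phi>\<close> are explicit parameters; \<open>f'\<close> and \<open>f''\<close> are
  \<open>deriv f\<close> and \<open>deriv (deriv f)\<close>.  The integrals are oriented Lebesgue integrals, so the
  endpoints may come in either order, and they are taken with respect to the completed measure
  because \<open>\<phi>\<close> is only assumed to be Lebesgue measurable.
\<close>

definition Linfty :: "(real \<Rightarrow> real) set" where
  "Linfty = {\<phi>. \<phi> \<in> borel_measurable lebesgue \<and> (\<exists>M. AE x in lebesgue. \<bar>\<phi> x\<bar> \<le> M)}"

definition E :: "(real \<Rightarrow> real) \<Rightarrow> (real \<Rightarrow> real) \<Rightarrow> real \<Rightarrow> real \<Rightarrow> real \<Rightarrow> real" where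
  "E f \<phi> u x t =
     t * (LINT s=ereal 0..ereal u|lebesgue. (deriv (deriv f) s * (\<phi> (x - t * deriv f s) - s)))"

definition maximizers :: "(real \<Rightarrow> real) \<Rightarrow> (real \<Rightarrow> real) \<Rightarrow> real \<Rightarrow> real \<Rightarrow> real set" where
  "maximizers f \<phi> x t = {u. \<forall>v. E f \<phi> v x t \<le> E f \<phi> u x t}"

definition entropy_sol :: "(real \<Rightarrow> real) \<Rightarrow> (real \<Rightarrow> real) \<Rightarrow> real \<Rightarrow> real \<Rightarrow> real" where
  "entropy_sol f \<phi> x t = Inf (maximizers f \<phi> x t)"

text \<open>
  The traces \<open>u(x-,t)\<close> and \<open>u(x+,t)\<close> are the genuine one-sided limits in \<open>x\<close>; that they are
  \<open>Sup\<close> and \<open>Inf\<close> of the set of maximizers is a fact about the entropy solution and is not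
  built into the definition.
\<close>

definition left_trace :: "(real \<Rightarrow> real) \<Rightarrow> (real \<Rightarrow> real) \<Rightarrow> real \<Rightarrow> real \<Rightarrow> real" where
  "left_trace f \<phi> x t = Lim (at_left x) (\<lambda>y. entropy_sol f \<phi> y t)"

definition right_trace :: "(real \<Rightarrow> real) \<Rightarrow> (real \<Rightarrow> real) \<Rightarrow> real \<Rightarrow> real \<Rightarrow> real" where
  "right_trace f \<phi> x t = Lim (at_right x) (\<lambda>y. entropy_sol f \<phi> y t)"

definition char_line :: "(real \<Rightarrow> real) \<Rightarrow> real \<Rightarrow> real \<Rightarrow> (real \<times> real) set" where
  "char_line f x\<^sub>0 c = {(x, t). x = x\<^sub>0 + t * deriv f c \<and> t > 0}"

definition emitting :: "(real \<Rightarrow> real) \<Rightarrow> (real \<Rightarrow> real) \<Rightarrow> real \<Rightarrow> real set" where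
  "emitting f \<phi> x\<^sub>0 = {c. \<exists>(x, t) \<in> char_line f x\<^sub>0 c. c \<in> maximizers f \<phi> x t}"

definition lifespan :: "(real \<Rightarrow> real) \<Rightarrow> (real \<Rightarrow> real) \<Rightarrow> real \<Rightarrow> real \<Rightarrow> ereal" where
  "lifespan f \<phi> x\<^sub>0 c =
     Sup (ereal ` {t. t > 0 \<and> c \<in> maximizers f \<phi> (x\<^sub>0 + t * deriv f c) t})"

definition Phi :: "(real \<Rightarrow> real) \<Rightarrow> real \<Rightarrow> real \<Rightarrow> real \<Rightarrow> real" where
  "Phi \<phi> l x\<^sub>0 c = (LINT \<xi>=ereal x\<^sub>0..ereal (x\<^sub>0 + l)|lebesgue. (\<phi> \<xi> - c))"

text \<open>
  \<open>f'\<close> is injective but need not be onto, so the next two definitions are meaningful only when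
  \<open>f'(c) - l/t\<close> lies in the (open) range of \<open>f'\<close>, as it does for all small \<open>l\<close>.
\<close>

definition fan :: "(real \<Rightarrow> real) \<Rightarrow> real \<Rightarrow> real \<Rightarrow> real \<Rightarrow> real" where
  "fan f l t c = inv (deriv f) (deriv f c - l / t)"

definition F :: "(real \<Rightarrow> real) \<Rightarrow> real \<Rightarrow> real \<Rightarrow> real \<Rightarrow> real" where
  "F f l t c =
     - t * (LINT s=ereal c..ereal (fan f l t c)|lebesgue. ((s - c) * deriv (deriv f) s))"

definition lifespan_bound_right ::
    "(real \<Rightarrow> real) \<Rightarrow> (real \<Rightarrow> real) \<Rightarrow> real \<Rightarrow> real \<Rightarrow> ereal" where
  "lifespan_bound_right f \<phi> x\<^sub>0 c =
     Sup (ereal ` {t. t > 0 \<and> (\<forall>\<^sub>F l in at_right 0. Phi \<phi> l x\<^sub>0 c > F f l t c)})"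

definition lifespan_bound_left ::
    "(real \<Rightarrow> real) \<Rightarrow> (real \<Rightarrow> real) \<Rightarrow> real \<Rightarrow> real \<Rightarrow> ereal" where
  "lifespan_bound_left f \<phi> x\<^sub>0 c =
     Sup (ereal ` {t. t > 0 \<and> (\<forall>\<^sub>F l in at_left 0. Phi \<phi> l x\<^sub>0 c > F f l t c)})"

definition lifespan_bound :: "(real \<Rightarrow> real) \<Rightarrow> (real \<Rightarrow> real) \<Rightarrow> real \<Rightarrow> real \<Rightarrow> ereal" where
  "lifespan_bound f \<phi> x\<^sub>0 c =
     min (lifespan_bound_right f \<phi> x\<^sub>0 c) (lifespan_bound_left f \<phi> x\<^sub>0 c)"

definition terminates_at ::
    "(real \<Rightarrow> real) \<Rightarrow> (real \<Rightarrow> real) \<Rightarrow> real \<Rightarrow> real \<Rightarrow> real \<Rightarrow> bool" where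
  "terminates_at f \<phi> x\<^sub>0 c t' \<longleftrightarrow>
     (\<forall>(x, t) \<in> char_line f x\<^sub>0 c.
        (t < t' \<longrightarrow> maximizers f \<phi> x t = {c}) \<and> (t > t' \<longrightarrow> c \<notin> maximizers f \<phi> x t))"

definition exists_for_all_time ::
    "(real \<Rightarrow> real) \<Rightarrow> (real \<Rightarrow> real) \<Rightarrow> real \<Rightarrow> real \<Rightarrow> bool" where
  "exists_for_all_time f \<phi> x\<^sub>0 c \<longleftrightarrow>
     (\<forall>(x, t) \<in> char_line f x\<^sub>0 c. maximizers f \<phi> x t = {c})"

text \<open>
  The value \<open>c\<close> is a maximizer at the point of the line
  \<open>char_line f x\<^sub>0 c\<close> with time \<open>t\<close> iff \<open>Phi \<phi> l x\<^sub>0 c \<ge> F f l t c\<close> for every \<open>l\<close> of the form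
  \<open>t * (deriv f c - deriv f u)\<close>.  Compression near \<open>x\<^sub>0\<close> is responsible for the termination at
  time \<open>t'\<close> if at every later time this criterion is already violated by arbitrarily small \<open>l\<close>,
  that is, by the datum arbitrarily close to \<open>x\<^sub>0\<close>.
\<close>

definition local_compression ::
    "(real \<Rightarrow> real) \<Rightarrow> (real \<Rightarrow> real) \<Rightarrow> real \<Rightarrow> real \<Rightarrow> real \<Rightarrow> bool" where
  "local_compression f \<phi> x\<^sub>0 c t' \<longleftrightarrow>
     (\<forall>t>t'. \<exists>\<^sub>F l in at 0. Phi \<phi> l x\<^sub>0 c < F f l t c)"

text \<open>
  Collision: a characteristic emitting from a point \<open>x\<^sub>1 \<noteq> x\<^sub>0\<close> of the \<open>x\<close>-axis reaches,
  without meeting a shock before, the point of \<open>char_line f x\<^sub>0 c\<close> with time \<open>t'\<close>.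
\<close>

definition collision_from_away ::
    "(real \<Rightarrow> real) \<Rightarrow> (real \<Rightarrow> real) \<Rightarrow> real \<Rightarrow> real \<Rightarrow> real \<Rightarrow> bool" where
  "collision_from_away f \<phi> x\<^sub>0 c t' \<longleftrightarrow>
     (\<exists>x\<^sub>1 c'. x\<^sub>1 \<noteq> x\<^sub>0 \<and> c' \<in> emitting f \<phi> x\<^sub>1 \<and>
        x\<^sub>1 + t' * deriv f c' = x\<^sub>0 + t' * deriv f c \<and>
        c' \<in> maximizers f \<phi> (x\<^sub>0 + t' * deriv f c) t' \<and>
        (\<forall>(x, t) \<in> char_line f x\<^sub>1 c'. t < t' \<longrightarrow> maximizers f \<phi> x t = {c'}))"

definition E_restart ::
    "(real \<Rightarrow> real) \<Rightarrow> (real \<Rightarrow> real) \<Rightarrow> real \<Rightarrow> real \<Rightarrow> real \<Rightarrow> real \<Rightarrow> real" where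
  "E_restart f \<phi> \<tau> v x t =
     (t - \<tau>) * (LINT s=ereal 0..ereal v|lebesgue.
        (deriv (deriv f) s * (entropy_sol f \<phi> (x - (t - \<tau>) * deriv f s) \<tau> - s)))"

definition maximizers_restart ::
    "(real \<Rightarrow> real) \<Rightarrow> (real \<Rightarrow> real) \<Rightarrow> real \<Rightarrow> real \<Rightarrow> real \<Rightarrow> real set" where
  "maximizers_restart f \<phi> \<tau> x t =
     {u. \<forall>v. E_restart f \<phi> \<tau> v x t \<le> E_restart f \<phi> \<tau> u x t}"

definition emitting_restart ::
    "(real \<Rightarrow> real) \<Rightarrow> (real \<Rightarrow> real) \<Rightarrow> real \<Rightarrow> real \<Rightarrow> real set" where
  "emitting_restart f \<phi> \<tau> x =
     {c. \<exists>t>\<tau>. c \<in> maximizers_restart f \<phi> \<tau> (x + (t - \<tau>) * deriv f c) t}"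

definition continuous_shock_generation_point ::
    "(real \<Rightarrow> real) \<Rightarrow> (real \<Rightarrow> real) \<Rightarrow> real \<Rightarrow> real \<Rightarrow> bool" where
  "continuous_shock_generation_point f \<phi> x t \<longleftrightarrow>
     t > 0 \<and> left_trace f \<phi> x t = right_trace f \<phi> x t \<and> emitting_restart f \<phi> t x = {}"

definition discontinuous_shock_generation_point ::
    "(real \<Rightarrow> real) \<Rightarrow> (real \<Rightarrow> real) \<Rightarrow> real \<Rightarrow> real \<Rightarrow> bool" where
  "discontinuous_shock_generation_point f \<phi> x t \<longleftrightarrow>
     t > 0 \<and> left_trace f \<phi> x t > right_trace f \<phi> x t \<and>
     maximizers f \<phi> x t = {right_trace f \<phi> x t..left_trace f \<phi> x t}"

definition point_of_shocks ::
    "(real \<Rightarrow> real) \<Rightarrow> (real \<Rightarrow> real) \<Rightarrow> real \<Rightarrow> real \<Rightarrow> bool" where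
  "point_of_shocks f \<phi> x t \<longleftrightarrow>
     t > 0 \<and> left_trace f \<phi> x t > right_trace f \<phi> x t \<and>
     maximizers f \<phi> x t \<subset> {right_trace f \<phi> x t..left_trace f \<phi> x t}"

text \<open>
  Membership of a point in some shock curve, in contrast to \<open>point_of_shocks\<close>: the solution
  jumps there, and nothing is said about the shape of the set of maximizers.
\<close>

definition on_shock :: "(real \<Rightarrow> real) \<Rightarrow> (real \<Rightarrow> real) \<Rightarrow> real \<Rightarrow> real \<Rightarrow> bool" where
  "on_shock f \<phi> x t \<longleftrightarrow>
     t > 0 \<and> left_trace f \<phi> x t > right_trace f \<phi> x t \<and>
     \<not> isCont (\<lambda>(y, s). entropy_sol f \<phi> y s) (x, t)"

end

theory Submission
  imports Defs
begin

text \<open>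
  Substituting \<open>\<xi> = x - t f'(s)\<close> turns the maximizers of \<open>E\<close> into the minimizers of the Hopf--Lax
  cost \<open>P (x - t f'(u)) + t G(u)\<close>, where \<open>P\<close> is a primitive of the datum and \<open>G(u) = f\<^sup>*(f'(u))\<close>.
  Strict convexity of \<open>f\<^sup>*\<close> makes \<open>c\<close> the only minimizer strictly before any time at which it is a
  minimizer, and makes \<open>F\<close> strictly increasing in \<open>t\<close>, so that \<open>lifespan \<le> lifespan_bound\<close>.  At the
  end of its lifespan \<open>c\<close> is still a minimizer; any other minimizer there is a collision and produces
  a jump, because the traces of the solution are the largest and the least minimizer.  If the bound
  has not been reached, the competitors that beat \<open>c\<close> immediately afterwards have feet away from
  \<open>x\<^sub>0\<close>, and by compactness one of them survives in the limit.  If \<open>c\<close> is the only minimizer, a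
  characteristic leaving the end point must continue with the value \<open>c\<close> (a kinked path is never
  optimal), which contradicts the maximality of the lifespan.
\<close>

section \<open>Integration on the line\<close>

text \<open>
  The difference quotients of the Lipschitz function are dominated by its Lipschitz constant, and
  their integrals converge because its primitive is differentiable at both end points.
\<close>

lemma has_integral_lipschitz_ae_derivative:
  fixes w w' :: "real \<Rightarrow> real"
  assumes N: "negligible N" and "a \<le> b"
    and lip: "\<And>x y. \<bar>w x - w y\<bar> \<le> M * \<bar>x - y\<bar>"
    and der: "\<And>x. x \<notin> N \<Longrightarrow> (w has_real_derivative w' x) (at x)"
  shows "(w' has_integral (w b - w a)) {a..b}"
proof -
  define d :: "nat \<Rightarrow> real" where "d n = inverse (real (Suc n))" for n
  have d: "0 < d n" "d n \<le> 1" for n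
    by (simp_all add: d_def inverse_eq_divide)
  have "d \<longlonglongrightarrow> 0"
    unfolding d_def by (rule LIMSEQ_inverse_real_of_nat)
  then have d0: "filterlim d (at 0) sequentially"
    using d by (auto simp: filterlim_at less_imp_neq[symmetric])
  have quot: "(\<lambda>n. (f (x + d n) - f x) / d n) \<longlonglongrightarrow> f'"
    if "(f has_real_derivative f') (at x)" for f f' x
    using filterlim_compose[OF that[unfolded DERIV_def] d0] .
  have "continuous_on UNIV w"
  proof -
    have "M \<ge> 0"
      using lip[of 1 0] by simp
    then have "M-lipschitz_on UNIV w"
      using lip by (intro lipschitz_onI) (auto simp: dist_real_def)
    then show ?thesis
      by (rule lipschitz_on_continuous_on)
  qed
  \<comment> \<open>The margins around \<open>{a..b}\<close> make \<open>Q\<close> differentiable at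
    every point of \<open>{a..b + 1}\<close>, which contains all shifted points
    \<open>x + d n\<close>.\<close>
  then obtain Q where Q: "\<And>x. x \<in> {a - 1..b + 2} \<Longrightarrow> (Q has_vector_derivative w x) (at x within {a - 1..b + 2})"
    using antiderivative_continuous[of "a - 1" "b + 2" w] continuous_on_subset by blast
  have Q: "(Q has_real_derivative w x) (at x)" if "a \<le> x" "x \<le> b + 1" for x
  proof -
    have "(Q has_vector_derivative w x) (at x within {a - 1..b + 2})"
      using that by (intro Q) auto
    moreover have "at x within {a - 1..b + 2} = at x"
      using that by (intro at_within_Icc_at) auto
    ultimately show ?thesis
      by (simp add: has_real_derivative_iff_has_vector_derivative)
  qed
  define q where "q n x = (Q (x + d n) - Q x) / d n" for n x
  \<comment> \<open>The value zero on \<open>N\<close> makes the difference quotients converge at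
    every point, not only almost everywhere.\<close>
  define r where "r n x = (if x \<in> N then 0 else (w (x + d n) - w x) / d n)" for n x
  have "((\<lambda>x. if x \<in> N then 0 else w' x) has_integral (w b - w a)) {a..b}"
  proof (rule has_integral_dominated_convergence)
    show "(r n has_integral (q n b - q n a)) {a..b}" for n
    proof (rule has_integral_spike[OF N])
      show "((\<lambda>x. (w (x + d n) - w x) / d n) has_integral (q n b - q n a)) {a..b}"
      proof (rule fundamental_theorem_of_calculus[OF \<open>a \<le> b\<close>])
        fix x
        assume "x \<in> {a..b}"
        then have "(Q has_real_derivative w (x + d n)) (at (x + d n))" "(Q has_real_derivative w x) (at x)"
          using d[of n] by (auto intro!: Q)
        then have "((\<lambda>x. Q (x + d n)) has_real_derivative w (x + d n)) (at x)"
          "(Q has_real_derivative w x) (at x)"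
          by (simp_all add: DERIV_shift)
        then have "(q n has_real_derivative (w (x + d n) - w x) / d n) (at x)"
          unfolding q_def by (intro DERIV_cdivide DERIV_diff)
        then show "(q n has_vector_derivative (w (x + d n) - w x) / d n) (at x within {a..b})"
          by (simp add: has_real_derivative_iff_has_vector_derivative has_vector_derivative_at_within)
      qed
    qed (simp add: r_def)
    show "(\<lambda>_. M) integrable_on {a..b}"
      by (rule integrable_const_ivl)
    show "\<forall>x\<in>{a..b}. norm (r n x) \<le> M" for n
    proof
      fix x
      have "\<bar>w (x + d n) - w x\<bar> \<le> M * d n"
        using d(1)[of n] lip[of "x + d n" x] by simp
      then show "norm (r n x) \<le> M"
        using d(1)[of n] abs_ge_zero[of "w 1 - w 0"] lip[of 1 0]
        by (auto simp: r_def pos_divide_le_eq)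
    qed
    show "\<forall>x\<in>{a..b}. (\<lambda>n. r n x) \<longlonglongrightarrow> (if x \<in> N then 0 else w' x)"
    proof
      show "(\<lambda>n. r n x) \<longlonglongrightarrow> (if x \<in> N then 0 else w' x)" for x
        using quot[of w "w' x" x] der[of x] by (cases "x \<in> N") (simp_all add: r_def)
    qed
    show "(\<lambda>n. q n b - q n a) \<longlonglongrightarrow> w b - w a"
      unfolding q_def by (intro tendsto_diff quot Q) (use \<open>a \<le> b\<close> in auto)
  qed
  then show ?thesis
    by (rule has_integral_spike[OF N, rotated]) simp
qed

text \<open>Stating the integral identity instead of a pointwise derivative covers data that are
  merely essentially bounded and measurable. Absolute integrability ties the gauge integral to the
  Lebesgue integrals in \<open>E\<close>, \<open>Phi\<close> and \<open>F\<close>.\<close>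

definition has_primitive :: "(real \<Rightarrow> real) \<Rightarrow> (real \<Rightarrow> real) \<Rightarrow> bool" where
  "has_primitive h H \<longleftrightarrow>
     (\<forall>a b. a \<le> b \<longrightarrow> h absolutely_integrable_on {a..b} \<and> integral {a..b} h = H b - H a)"

lemma LINT_eq_primitive:
  assumes "has_primitive h H"
  shows "(LINT s=ereal a..ereal b|lebesgue. h s) = H b - H a"
proof -
  have *: "(LINT s:{a<..<b}|lebesgue. h s) = H b - H a" if "a \<le> b" for a b
  proof -
    have "h absolutely_integrable_on {a<..<b}" "integral {a<..<b} h = H b - H a"
      using assms that
      by (auto simp: has_primitive_def absolutely_integrable_on_Icc_iff_Ioo integral_open_interval_real)
    then show ?thesis
      by (simp add: set_lebesgue_integral_eq_integral)
  qed
  show ?thesis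
    using *[of a b] *[of b a] by (simp add: interval_lebesgue_integral_def)
qed

lemma has_primitive_diff:
  assumes "has_primitive h H" "has_primitive k K"
  shows "has_primitive (\<lambda>x. h x - k x) (\<lambda>x. H x - K x)"
  using assms
  by (auto simp: has_primitive_def Henstock_Kurzweil_Integration.integral_diff
      set_lebesgue_integral_eq_integral)

lemma has_primitive_derivative:
  assumes "\<And>x. (H has_real_derivative h x) (at x)" "continuous_on UNIV h"
  shows "has_primitive h H"
  unfolding has_primitive_def
proof (intro allI impI conjI)
  fix a b :: real
  assume "a \<le> b"
  show "h absolutely_integrable_on {a..b}"
    using assms(2) by (intro absolutely_integrable_continuous_real) (rule continuous_on_subset, auto)
  have "(h has_integral (H b - H a)) {a..b}"
    using assms(1) \<open>a \<le> b\<close>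
    by (intro fundamental_theorem_of_calculus)
      (auto simp: has_real_derivative_iff_has_vector_derivative has_vector_derivative_at_within)
  then show "integral {a..b} h = H b - H a"
    by (rule integral_unique)
qed

text \<open>Setting the datum to zero where it exceeds its essential bound changes it on a null set
  only. The result is bounded and measurable, and its bound is the Lipschitz constant of the
  primitive.\<close>

lemma has_primitive_Linfty:
  assumes "\<phi> \<in> Linfty"
  obtains P M where "has_primitive \<phi> P" "\<And>a b. \<bar>P a - P b\<bar> \<le> M * \<bar>a - b\<bar>"
proof -
  obtain M0 where meas: "\<phi> \<in> borel_measurable lebesgue" and "AE x in lebesgue. \<bar>\<phi> x\<bar> \<le> M0"
    using assms by (auto simp: Linfty_def)
  then obtain N0 where N0: "N0 \<in> null_sets lebesgue" "{x. \<not> \<bar>\<phi> x\<bar> \<le> M0} \<subseteq> N0"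
    by (auto simp: eventually_ae_filter)
  define M where "M = \<bar>M0\<bar>"
  define N where "N = {x. \<not> \<bar>\<phi> x\<bar> \<le> M}"
  have N: "negligible N"
    unfolding negligible_iff_null_sets
    by (rule null_sets_completion_subset[OF _ N0(1)]) (use N0(2) in \<open>auto simp: N_def M_def\<close>)
  define h where "h x = (if \<bar>\<phi> x\<bar> \<le> M then \<phi> x else 0)" for x
  have h_meas: "h \<in> borel_measurable lebesgue"
    unfolding h_def using meas by measurable
  have h_bound: "norm (h x) \<le> M" for x
    by (simp add: h_def M_def)
  have h_int: "h integrable_on {a..b}" for a b
  proof (rule measurable_bounded_by_integrable_imp_integrable)
    show "h \<in> borel_measurable (lebesgue_on {a..b})"
      using h_meas by (rule measurable_restrict_space1)
    show "(\<lambda>_. M) integrable_on {a..b}"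
      by (rule integrable_const_ivl)
  qed (use h_bound in simp_all)
  then have "h absolutely_integrable_on {a..b}" for a b
    using h_bound integrable_const_ivl by (intro absolutely_integrable_integrable_bound)
  then have abs_int: "\<phi> absolutely_integrable_on {a..b}" for a b
    by (rule absolutely_integrable_spike[OF _ N]) (auto simp: h_def N_def)
  then have int: "\<phi> integrable_on {a..b}" for a b
    by (simp add: set_lebesgue_integral_eq_integral)
  have bound: "\<bar>integral {a..b} \<phi>\<bar> \<le> M * (b - a)" if "a \<le> b" for a b
  proof -
    have "integral {a..b} \<phi> = integral {a..b} h"
      by (rule integral_spike[OF N]) (auto simp: h_def N_def)
    moreover have "norm (integral {a..b} h) \<le> M * (b - a)"
      using has_integral_bound_real[OF _ finite.emptyI integrable_integral[OF h_int], of M a b]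
        h_bound that by (simp add: M_def)
    ultimately show ?thesis
      by simp
  qed
  define P where "P y = (if 0 \<le> y then integral {0..y} \<phi> else - integral {y..0} \<phi>)" for y
  have P: "integral {a..b} \<phi> = P b - P a" if "a \<le> b" for a b
    using Henstock_Kurzweil_Integration.integral_combine[OF _ _ int, of 0 a b]
      Henstock_Kurzweil_Integration.integral_combine[OF _ _ int, of a 0 b]
      Henstock_Kurzweil_Integration.integral_combine[OF _ _ int, of a b 0] that
    by (auto simp: P_def)
  have "\<bar>P a - P b\<bar> \<le> M * \<bar>a - b\<bar>" for a b
    using bound[of a b] bound[of b a] P[of a b] P[of b a] by (cases "a \<le> b") auto
  moreover have "has_primitive \<phi> P"
    using abs_int P by (simp add: has_primitive_def)
  ultimately show ?thesis
    using that by blast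
qed

text \<open>The map \<open>x - t * g s\<close> decreases in \<open>s\<close> with derivative
  \<open>- (t * g' s)\<close>: the absolute value in the change of variables formula produces
  \<open>t * g' s\<close>, and the end points are exchanged. Strict monotonicity of \<open>g\<close>
  gives injectivity even where \<open>g'\<close> vanishes.\<close>

lemma has_primitive_substitution:
  assumes "has_primitive h H" "t > 0" "strict_mono g"
    and der: "\<And>s. (g has_real_derivative g' s) (at s)" and "\<And>s. g' s \<ge> 0"
  shows "has_primitive (\<lambda>s. g' s * h (x - t * g s)) (\<lambda>s. - H (x - t * g s) / t)"
  unfolding has_primitive_def
proof (intro allI impI)
  fix a b :: real
  assume "a \<le> b"
  define p where "p s = x - t * g s" for s
  have p_less: "p v < p u \<longleftrightarrow> u < v" for u v
    using assms(2) strict_mono_less[OF assms(3)] by (simp add: p_def)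
  then have p_le: "p v \<le> p u \<longleftrightarrow> u \<le> v" for u v
    by (metis linorder_not_less)
  have p_der: "(p has_real_derivative - (t * g' s)) (at s)" for s
    unfolding p_def by (auto intro!: derivative_eq_intros der)
  have image: "p ` {a..b} = {p b..p a}"
  proof
    show "p ` {a..b} \<subseteq> {p b..p a}"
      using p_le by auto
    show "{p b..p a} \<subseteq> p ` {a..b}"
    proof
      fix y
      assume "y \<in> {p b..p a}"
      moreover have "isCont p s" for s
        using p_der by (rule DERIV_isCont)
      ultimately show "y \<in> p ` {a..b}"
        using IVT2[of p b y a] \<open>a \<le> b\<close> by auto
    qed
  qed
  have "h absolutely_integrable_on p ` {a..b}" "integral (p ` {a..b}) h = H (p a) - H (p b)"
    using assms(1) p_le[of b a] \<open>a \<le> b\<close> by (auto simp: image has_primitive_def)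
  moreover have "inj_on p {a..b}"
    by (rule inj_onI) (metis p_less less_irrefl linorder_neqE_linordered_idom)
  ultimately have "(\<lambda>s. \<bar>- (t * g' s)\<bar> * h (p s)) absolutely_integrable_on {a..b}"
    "integral {a..b} (\<lambda>s. \<bar>- (t * g' s)\<bar> * h (p s)) = H (p a) - H (p b)"
    using has_absolute_integral_change_of_variables_1'[of "{a..b}" p "\<lambda>s. - (t * g' s)" h]
      has_field_derivative_at_within[OF p_der] by auto
  moreover have "\<bar>- (t * g' s)\<bar> = t * g' s" for s
    using assms by simp
  ultimately have "(\<lambda>s. t * (g' s * h (p s))) absolutely_integrable_on {a..b}"
    "t * integral {a..b} (\<lambda>s. g' s * h (p s)) = H (p a) - H (p b)"
    by (simp_all only: mult.assoc flip: integral_mult_right)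
  then show "(\<lambda>s. g' s * h (x - t * g s)) absolutely_integrable_on {a..b} \<and>
    integral {a..b} (\<lambda>s. g' s * h (x - t * g s)) = - H (x - t * g b) / t - - H (x - t * g a) / t"
    using \<open>t > 0\<close> by (simp add: p_def field_simps)
qed

section \<open>The Hopf--Lax cost\<close>

text \<open>Here \<open>g\<close> stands for the derivative of the flux, \<open>P\<close> for a
  primitive of the datum, and \<open>G\<close> for the Legendre transform read at the slope
  \<open>g u\<close>. The inequality \<open>subgradient\<close> is the strict convexity of that
  transform, written in the variable \<open>u\<close> so that \<open>g\<close> never has to be
  inverted. Keeping \<open>P\<close> general allows a second use with the solution at a later time
  as datum.\<close>

locale hopf_lax =
  fixes g G P :: "real \<Rightarrow> real" and M :: real
  assumes cont_g: "continuous_on UNIV g"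
    and subgradient: "\<And>u v. u \<noteq> v \<Longrightarrow> u * (g v - g u) < G v - G u"
    and lipschitz: "\<And>a b. \<bar>P a - P b\<bar> \<le> M * \<bar>a - b\<bar>"
begin

text \<open>The value of \<open>P\<close> at the foot of the straight path with speed
  \<open>g u\<close> ending in \<open>(x, t)\<close>, plus the action of that path.\<close>

definition cost :: "real \<Rightarrow> real \<Rightarrow> real \<Rightarrow> real" where
  "cost u x t = P (x - t * g u) + t * G u"

definition argmins :: "real \<Rightarrow> real \<Rightarrow> real set" where
  "argmins x t = {u. \<forall>v. cost u x t \<le> cost v x t}"

definition least :: "real \<Rightarrow> real \<Rightarrow> real" where
  "least x t = Inf (argmins x t)"

definition val :: "real \<Rightarrow> real \<Rightarrow> real" where
  "val x t = cost (least x t) x t"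

lemma M_nonneg: "M \<ge> 0"
  using lipschitz[of 1 0] by simp

text \<open>Adding the subgradient inequalities at \<open>u\<close> and at \<open>v\<close> gives
  \<open>0 < (v - u) * (g v - g u)\<close>.\<close>

lemma strict_mono_g: "strict_mono g"
proof (rule strict_monoI)
  fix u v :: real
  assume "u < v"
  then have "0 < (v - u) * (g v - g u)"
    using subgradient[of u v] subgradient[of v u] by (simp add: algebra_simps)
  with \<open>u < v\<close> show "g u < g v"
    by (simp add: zero_less_mult_iff)
qed

lemma g_less_iff [simp]: "g u < g v \<longleftrightarrow> u < v"
  using strict_mono_g by (rule strict_mono_less)

lemma g_le_iff [simp]: "g u \<le> g v \<longleftrightarrow> u \<le> v"
  using strict_mono_g by (rule strict_mono_less_eq)

lemma g_eq_iff [simp]: "g u = g v \<longleftrightarrow> u = v"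
  using strict_mono_g by (rule strict_mono_eq)

lemma isCont_g: "isCont g u"
  using cont_g continuous_on_eq_continuous_at by blast

lemma tendsto_g: "(h \<longlongrightarrow> u) X \<Longrightarrow> ((\<lambda>n. g (h n)) \<longlongrightarrow> g u) X"
  using isCont_g by (rule isCont_tendsto_compose)

lemma subgradient_le: "u * (g v - g u) \<le> G v - G u"
  using subgradient[of u v] by (cases "u = v") auto

lemma g_attains: "g u \<le> p \<Longrightarrow> p \<le> g v \<Longrightarrow> \<exists>w. u \<le> w \<and> w \<le> v \<and> g w = p"
  using IVT[of g u p v] isCont_g g_le_iff[of u v] by (meson order_trans)

text \<open>The subgradient inequalities at \<open>u\<close> and at \<open>v\<close> squeeze
  \<open>G v - G u\<close> between \<open>u * (g v - g u)\<close> and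
  \<open>v * (g v - g u)\<close>, and \<open>g\<close> is continuous.\<close>

lemma continuous_on_G: "continuous_on UNIV G"
proof -
  have "(G \<longlongrightarrow> G u) (at u)" for u
  proof -
    have "((\<lambda>v. G v - G u) \<longlongrightarrow> 0) (at u)"
    proof (rule tendsto_sandwich)
      show "\<forall>\<^sub>F v in at u. u * (g v - g u) \<le> G v - G u"
        by (simp add: subgradient_le)
      show "\<forall>\<^sub>F v in at u. G v - G u \<le> v * (g v - g u)"
        using subgradient_le[where v = u] by (simp add: algebra_simps)
      have "(g \<longlongrightarrow> g u) (at u)"
        by (intro tendsto_g tendsto_ident_at)
      then show "((\<lambda>v. u * (g v - g u)) \<longlongrightarrow> 0) (at u)" "((\<lambda>v. v * (g v - g u)) \<longlongrightarrow> 0) (at u)"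
        by (auto intro!: tendsto_eq_intros)
    qed
    then show ?thesis
      by (simp add: LIM_zero_iff)
  qed
  then show ?thesis
    by (simp add: continuous_on_def)
qed

lemma tendsto_G: "(h \<longlongrightarrow> u) X \<Longrightarrow> ((\<lambda>n. G (h n)) \<longlongrightarrow> G u) X"
  using continuous_on_G by (auto simp: continuous_on_eq_continuous_at intro: isCont_tendsto_compose)

lemma tendsto_P:
  assumes "(h \<longlongrightarrow> a) X"
  shows "((\<lambda>n. P (h n)) \<longlongrightarrow> P a) X"
proof -
  have "((\<lambda>n. M * \<bar>h n - a\<bar>) \<longlongrightarrow> 0) X"
    using assms by (auto intro!: tendsto_eq_intros)
  then have "((\<lambda>n. P (h n) - P a) \<longlongrightarrow> 0) X"
    by (rule Lim_null_comparison[rotated]) (simp add: lipschitz)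
  then show ?thesis
    by (simp add: LIM_zero_iff)
qed

lemma tendsto_cost:
  assumes "(u \<longlongrightarrow> u') X" "(x \<longlongrightarrow> x') X" "(t \<longlongrightarrow> t') X"
  shows "((\<lambda>n. cost (u n) (x n) (t n)) \<longlongrightarrow> cost u' x' t') X"
  unfolding cost_def using assms by (intro tendsto_add tendsto_mult tendsto_diff tendsto_P tendsto_g tendsto_G)

text \<open>Strict convexity in the form used throughout: a path that runs for time \<open>s\<close>
  with speed \<open>g u\<close> and for time \<open>r\<close> with speed \<open>g w\<close> is
  strictly costlier than the straight path with the same ends, whose label is
  \<open>v\<close>.\<close>

lemma junction:
  assumes "0 < s" "0 < r" "u \<noteq> w"
  shows "\<exists>v. (s + r) * g v = s * g u + r * g w \<and> (s + r) * G v < s * G u + r * G w"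
proof -
  define p where "p = (s * g u + r * g w) / (s + r)"
  have p: "(s + r) * p = s * g u + r * g w"
    using assms by (simp add: p_def)
  \<comment> \<open>The mean speed \<open>p\<close> lies between \<open>g u\<close> and
    \<open>g w\<close>, hence in the range of \<open>g\<close>, although \<open>g\<close> need not
    be onto.\<close>
  have "min (g u) (g w) * (s + r) \<le> s * g u + r * g w"
    "s * g u + r * g w \<le> max (g u) (g w) * (s + r)"
    using assms by (simp_all add: ring_distribs mult.commute add_mono mult_left_mono)
  then have "g (min u w) \<le> p" "p \<le> g (max u w)"
    using assms by (auto simp: p_def field_simps min_def max_def split: if_splits)
  then obtain v where v: "g v = p"
    using g_attains by blast
  have "v * (g u - g v) \<le> G u - G v" "v * (g w - g v) \<le> G w - G v"
    by (rule subgradient_le)+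
  moreover have "v * (g u - g v) < G u - G v \<or> v * (g w - g v) < G w - G v"
    using subgradient[of v u] subgradient[of v w] \<open>u \<noteq> w\<close> by auto
  ultimately have "s * (v * (g u - g v)) + r * (v * (g w - g v)) < s * (G u - G v) + r * (G w - G v)"
    using assms by (smt (verit) mult_less_cancel_left_pos)
  \<comment> \<open>The weighted deviations from the mean speed cancel.\<close>
  moreover have "s * (v * (g u - g v)) + r * (v * (g w - g v)) = 0"
  proof -
    have "s * (v * (g u - g v)) + r * (v * (g w - g v)) = v * (s * g u + r * g w - (s + r) * g v)"
      by (simp add: algebra_simps)
    then show ?thesis
      using p v by simp
  qed
  ultimately have "(s + r) * G v < s * G u + r * G w"
    by (simp add: algebra_simps)
  with v p show ?thesis
    by auto
qed

section \<open>Bounds, existence and semicontinuity of minimizers\<close>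

lemma cost_gt_right:
  assumes "t > 0" "M < u"
  shows "cost M x t < cost u x t"
proof -
  \<comment> \<open>Passing from \<open>u\<close> to \<open>M\<close> moves the foot by
    \<open>t * (g u - g M)\<close>; the Lipschitz bound on \<open>P\<close> limits the loss, and the
    subgradient inequality at \<open>M\<close> makes the gain in \<open>G\<close> strictly
    larger.\<close>
  have "P (x - t * g M) - P (x - t * g u) \<le> M * (t * (g u - g M))"
    using lipschitz[of "x - t * g M" "x - t * g u"] assms
    by (simp add: abs_mult right_diff_distrib abs_if split: if_splits)
  moreover have "t * (M * (g u - g M)) < t * (G u - G M)"
    using subgradient[of M u] assms by simp
  ultimately show ?thesis
    by (simp add: cost_def algebra_simps)
qed

lemma cost_gt_left:
  assumes "t > 0" "u < - M"
  shows "cost (- M) x t < cost u x t"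
proof -
  have "P (x - t * g (- M)) - P (x - t * g u) \<le> M * \<bar>t * (g u - g (- M))\<bar>"
    using lipschitz[of "x - t * g (- M)" "x - t * g u"] by (simp add: algebra_simps)
  also have "\<bar>t * (g u - g (- M))\<bar> = t * (g (- M) - g u)"
    using assms by (simp add: abs_mult)
  finally have "P (x - t * g (- M)) - P (x - t * g u) \<le> M * (t * (g (- M) - g u))" .
  moreover have "t * (- M * (g u - g (- M))) < t * (G u - G (- M))"
    using subgradient[of "- M" u] assms by (intro mult_strict_left_mono) auto
  moreover have "t * (M * (g (- M) - g u)) = t * (- M * (g u - g (- M)))"
    by (simp add: algebra_simps)
  ultimately show ?thesis
    by (simp add: cost_def algebra_simps)
qed

lemma argmins_bounded:
  assumes "t > 0"
  shows "argmins x t \<subseteq> {- M..M}"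
proof
  fix u
  assume "u \<in> argmins x t"
  then have "\<not> cost M x t < cost u x t" "\<not> cost (- M) x t < cost u x t"
    by (simp_all add: argmins_def not_less)
  then show "u \<in> {- M..M}"
    using cost_gt_left[OF assms, of u x] cost_gt_right[OF assms, of u x] by force
qed

text \<open>Outside \<open>{- M..M}\<close> one of the end points is strictly better, so a minimizer
  over this compact interval is a global one.\<close>

lemma argmins_nonempty:
  assumes "t > 0"
  shows "argmins x t \<noteq> {}"
proof -
  have "continuous_on {- M..M} (\<lambda>u. cost u x t)"
    unfolding continuous_on_def by (intro ballI tendsto_cost tendsto_const tendsto_ident_at)
  moreover have "{- M..M} \<noteq> {}"
    using M_nonneg by simp
  ultimately obtain m where m: "\<And>v. v \<in> {- M..M} \<Longrightarrow> cost m x t \<le> cost v x t"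
    using continuous_attains_inf[OF compact_Icc] by blast
  have "cost m x t \<le> cost v x t" for v
    using m[of v] m[of M] m[of "- M"] M_nonneg cost_gt_left[OF assms, of v x]
      cost_gt_right[OF assms, of v x]
    by (cases "v < - M"; cases "M < v") auto
  then show ?thesis
    by (auto simp: argmins_def)
qed

text \<open>The cost is jointly continuous, so its inequalities pass to the limit. The general
  filter serves both sequences and one-sided limits in time along a characteristic.\<close>

lemma argmins_closed_graph:
  assumes "X \<noteq> bot" "(u \<longlongrightarrow> u') X" "(x \<longlongrightarrow> x') X" "(t \<longlongrightarrow> t') X"
    and "\<forall>\<^sub>F n in X. u n \<in> argmins (x n) (t n)"
  shows "u' \<in> argmins x' t'"
proof -
  have "cost u' x' t' \<le> cost v x' t'" for v
  proof (rule tendsto_le[OF assms(1)])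
    show "\<forall>\<^sub>F n in X. cost (u n) (x n) (t n) \<le> cost v (x n) (t n)"
      using assms(5) by eventually_elim (simp add: argmins_def)
  qed (intro tendsto_cost tendsto_const assms)+
  then show ?thesis
    by (simp add: argmins_def)
qed

lemma compact_argmins:
  assumes "t > 0"
  shows "compact (argmins x t)"
proof -
  have "closed (argmins x t)"
    unfolding closed_sequential_limits
    using argmins_closed_graph[OF sequentially_bot _ tendsto_const tendsto_const] by auto
  moreover have "bounded (argmins x t)"
    by (rule bounded_subset[OF bounded_closed_interval argmins_bounded[OF assms]])
  ultimately show ?thesis
    by (simp add: compact_eq_bounded_closed)
qed

text \<open>Otherwise there are minimizers outside \<open>S\<close> at points tending to
  \<open>(x, t)\<close>. They stay in \<open>{- M..M}\<close>, and the limit of a convergent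
  subsequence is a minimizer at \<open>(x, t)\<close> outside the open set \<open>S\<close>.\<close>

lemma argmins_upper_semicontinuous:
  assumes "t > 0" "open S" "argmins x t \<subseteq> S"
  shows "\<forall>\<^sub>F z in nhds (x, t). argmins (fst z) (snd z) \<subseteq> S"
proof (rule ccontr)
  assume "\<not> ?thesis"
  then obtain z where z: "z \<longlonglongrightarrow> (x, t)" "\<not> (\<forall>\<^sub>F n in sequentially. argmins (fst (z n)) (snd (z n)) \<subseteq> S)"
    by (auto simp: eventually_nhds_iff_sequentially)
  have tz: "(\<lambda>n. fst (z n)) \<longlonglongrightarrow> x" "(\<lambda>n. snd (z n)) \<longlonglongrightarrow> t"
    using tendsto_fst[OF z(1)] tendsto_snd[OF z(1)] by auto
  have pos: "\<forall>\<^sub>F n in sequentially. snd (z n) > 0"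
    using tz(2) assms(1) order_tendstoD(1) by blast
  have "\<exists>\<^sub>F n in sequentially. snd (z n) > 0 \<and> \<not> argmins (fst (z n)) (snd (z n)) \<subseteq> S"
    using frequently_eventually_frequently[OF z(2)[unfolded not_eventually] pos]
    by (simp add: conj_commute)
  then obtain r :: "nat \<Rightarrow> nat" where r: "strict_mono r"
    "\<And>n. snd (z (r n)) > 0 \<and> \<not> argmins (fst (z (r n))) (snd (z (r n))) \<subseteq> S"
    using infinite_enumerate[of "{n. snd (z n) > 0 \<and> \<not> argmins (fst (z n)) (snd (z n)) \<subseteq> S}"]
    by (auto simp: cofinite_eq_sequentially[symmetric] frequently_cofinite)
  then have "\<forall>n. \<exists>u. u \<in> argmins (fst (z (r n))) (snd (z (r n))) \<and> u \<notin> S \<and> u \<in> {- M..M}"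
    using argmins_bounded by blast
  then obtain u where u: "\<And>n. u n \<in> argmins (fst (z (r n))) (snd (z (r n)))" "\<And>n. u n \<notin> S"
    "\<And>n. u n \<in> {- M..M}"
    by metis
  obtain l q where q: "strict_mono q" "(u \<circ> q) \<longlonglongrightarrow> l"
    using u(3) compact_Icc[of "- M" M] unfolding compact_def by blast
  have "l \<in> argmins x t"
  proof (rule argmins_closed_graph[OF sequentially_bot q(2)])
    show "(\<lambda>n. fst (z (r (q n)))) \<longlonglongrightarrow> x" "(\<lambda>n. snd (z (r (q n)))) \<longlonglongrightarrow> t"
      using LIMSEQ_subseq_LIMSEQ[OF tz(1) strict_mono_o[OF r(1) q(1)]]
        LIMSEQ_subseq_LIMSEQ[OF tz(2) strict_mono_o[OF r(1) q(1)]]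
      by (simp_all add: o_def)
  qed (simp add: u)
  moreover have "l \<in> - S"
    using assms(2) q(2) u(2) by (intro closed_sequentially[of "- S" "u \<circ> q" l]) auto
  ultimately show False
    using assms(3) by blast
qed

lemma
  assumes "t > 0"
  shows least_in_argmins: "least x t \<in> argmins x t"
    and Sup_in_argmins: "Sup (argmins x t) \<in> argmins x t"
    and least_le: "u \<in> argmins x t \<Longrightarrow> least x t \<le> u"
    and le_Sup_argmins: "u \<in> argmins x t \<Longrightarrow> u \<le> Sup (argmins x t)"
proof -
  have ne: "argmins x t \<noteq> {}" and "compact (argmins x t)"
    using assms by (rule argmins_nonempty, rule compact_argmins)
  then have cl: "closed (argmins x t)" and bd: "bdd_below (argmins x t)" "bdd_above (argmins x t)"
    by (simp_all add: compact_imp_closed compact_imp_bounded bounded_imp_bdd_below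
        bounded_imp_bdd_above)
  show "least x t \<in> argmins x t" "Sup (argmins x t) \<in> argmins x t"
    unfolding least_def
    by (rule closed_contains_Inf[OF ne bd(1) cl], rule closed_contains_Sup[OF ne bd(2) cl])
  show "u \<in> argmins x t \<Longrightarrow> least x t \<le> u" "u \<in> argmins x t \<Longrightarrow> u \<le> Sup (argmins x t)"
    unfolding least_def using bd by (simp_all add: cInf_lower cSup_upper)
qed

lemma val_le_cost: "t > 0 \<Longrightarrow> val x t \<le> cost v x t"
  using least_in_argmins[of t x] by (simp add: val_def argmins_def)

lemma val_eq_cost: "t > 0 \<Longrightarrow> u \<in> argmins x t \<Longrightarrow> val x t = cost u x t"
  by (intro order_antisym val_le_cost) (simp_all add: argmins_def val_def)

text \<open>Following \<open>u\<close> up to time \<open>s\<close> and \<open>c\<close> afterwards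
  gives a kinked path to the point at time \<open>t\<close>. The straight path \<open>v\<close> with
  the same foot is strictly cheaper than this, yet not cheaper than \<open>c\<close>, so
  \<open>u\<close> loses to \<open>c\<close> already at time \<open>s\<close>.\<close>

lemma characteristic_argmins:
  assumes "c \<in> argmins (a + t * g c) t" "0 < s" "s < t"
  shows "argmins (a + s * g c) s = {c}"
proof -
  have "cost c (a + s * g c) s < cost u (a + s * g c) s" if "u \<noteq> c" for u
  proof -
    obtain v where v: "t * g v = s * g u + (t - s) * g c" "t * G v < s * G u + (t - s) * G c"
      using junction[of s "t - s" u c] assms \<open>u \<noteq> c\<close> by auto
    have "cost c (a + t * g c) t \<le> cost v (a + t * g c) t"
      using assms by (simp add: argmins_def)
    moreover have "a + t * g c - t * g v = a + s * g c - s * g u"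
      using v by (simp add: algebra_simps)
    ultimately show ?thesis
      using v(2) by (simp add: cost_def algebra_simps)
  qed
  then show ?thesis
    using argmins_nonempty[OF \<open>0 < s\<close>] by (force simp: argmins_def not_less[symmetric])
qed

text \<open>If the feet were in the wrong order, exchanging them would lower the total cost.\<close>

lemma foot_mono:
  assumes "t > 0" "x < y" "u \<in> argmins x t" "w \<in> argmins y t"
  shows "x - t * g u \<le> y - t * g w"
proof (rule ccontr)
  define d where "d = (x - t * g u) - (y - t * g w)"
  assume "\<not> ?thesis"
  then have d: "d > 0" "t * (g w - g u) = (y - x) + d"
    by (auto simp: d_def algebra_simps)
  then have "u \<noteq> w"
    using \<open>x < y\<close> by auto
  \<comment> \<open>\<open>v\<close> labels the path from the foot of \<open>w\<close> to
    \<open>x\<close>, and \<open>v'\<close> below the one from the foot of \<open>u\<close> to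
    \<open>y\<close>. Both speeds average \<open>g u\<close> and \<open>g w\<close>, with the
    weights \<open>y - x\<close> and \<open>d\<close> exchanged, so the total action strictly
    drops.\<close>
  obtain v where v: "(y - x + d) * g v = (y - x) * g u + d * g w"
    "(y - x + d) * G v < (y - x) * G u + d * G w"
    using junction[of "y - x" d u w] assms d \<open>u \<noteq> w\<close> by auto
  obtain v' where v': "(y - x + d) * g v' = d * g u + (y - x) * g w"
    "(y - x + d) * G v' < d * G u + (y - x) * G w"
    using junction[of d "y - x" u w] assms d \<open>u \<noteq> w\<close> by (auto simp: add.commute)
  have pos: "y - x + d > 0"
    using assms d by simp
  have "(y - x + d) * (g v - g u) = d * (g w - g u)"
    using v by (simp add: algebra_simps)
  then have "(y - x + d) * (t * (g v - g u)) = (y - x + d) * d"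
    using d(2) by (metis mult.left_commute mult.commute)
  then have "t * (g v - g u) = d"
    using pos by simp
  then have gv: "t * g v = t * g u + d"
    by (simp add: algebra_simps)
  have "(y - x + d) * (g w - g v') = d * (g w - g u)"
    using v' by (simp add: algebra_simps)
  then have "(y - x + d) * (t * (g w - g v')) = (y - x + d) * d"
    using d(2) by (metis mult.left_commute mult.commute)
  then have "t * (g w - g v') = d"
    using pos by simp
  then have gv': "t * g v' = t * g w - d"
    by (simp add: algebra_simps)
  have "(y - x + d) * (G v + G v') < (y - x + d) * (G u + G w)"
    using v v' by (simp add: algebra_simps)
  then have "t * (G v + G v') < t * (G u + G w)"
    using pos assms by simp
  moreover have "cost u x t \<le> cost v x t" "cost w y t \<le> cost v' y t"
    using assms by (simp_all add: argmins_def)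
  moreover have "x - t * g v = y - t * g w" "y - t * g v' = x - t * g u"
    using gv gv' by (simp_all add: d_def)
  ultimately show False
    by (simp add: cost_def algebra_simps)
qed

section \<open>One-sided limits of the least minimizer\<close>

lemma argmins_near:
  assumes "t > 0" "open S" "argmins x t \<subseteq> S"
  shows "\<forall>\<^sub>F y in nhds x. argmins y t \<subseteq> S"
proof -
  have "((\<lambda>y. (y, t)) \<longlongrightarrow> (x, t)) (nhds x)"
    by (intro tendsto_intros) (simp add: filterlim_ident)
  then show ?thesis
    using argmins_upper_semicontinuous[OF assms] by (auto simp: filterlim_iff)
qed

text \<open>The upper bound is semicontinuity. For the lower bound, the foot of
  \<open>least y t\<close> with \<open>y < x\<close> lies weakly to the left of the foot of the
  largest minimizer at \<open>x\<close>, so its speed falls short of that of the largest minimizer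
  by at most \<open>(x - y) / t\<close>.\<close>

lemma least_tendsto_left:
  assumes "t > 0"
  shows "((\<lambda>y. least y t) \<longlongrightarrow> Sup (argmins x t)) (at_left x)"
proof (rule order_tendstoI)
  let ?S = "Sup (argmins x t)"
  fix a assume "?S < a"
  then have "argmins x t \<subseteq> {..<a}"
    using le_Sup_argmins[OF assms] by fastforce
  then have "\<forall>\<^sub>F y in nhds x. argmins y t \<subseteq> {..<a}"
    by (rule argmins_near[OF assms open_lessThan])
  then have "\<forall>\<^sub>F y in nhds x. least y t < a"
  proof (rule eventually_mono)
    show "least y t < a" if "argmins y t \<subseteq> {..<a}" for y
      using subsetD[OF that least_in_argmins[OF assms]] by simp
  qed
  then show "\<forall>\<^sub>F y in at_left x. least y t < a"
    by (simp add: eventually_at_filter eventually_mono)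
next
  let ?S = "Sup (argmins x t)"
  fix a assume "a < ?S"
  then have "((\<lambda>y. t * (g ?S - g a) + y) \<longlongrightarrow> t * (g ?S - g a) + x) (at_left x)" "0 < t * (g ?S - g a)"
    using assms by (auto intro!: tendsto_intros)
  then have "\<forall>\<^sub>F y in at_left x. x < t * (g ?S - g a) + y"
    by (intro order_tendstoD) auto
  moreover have "\<forall>\<^sub>F y in at_left x. y < x"
    by (simp add: eventually_at_filter)
  ultimately show "\<forall>\<^sub>F y in at_left x. a < least y t"
  proof eventually_elim
    case (elim y)
    have "y - t * g (least y t) \<le> x - t * g ?S"
      using elim assms by (intro foot_mono least_in_argmins Sup_in_argmins)
    then have "t * g a < t * g (least y t)"
      using elim by (simp add: algebra_simps)
    then show ?case
      using assms by simp
  qed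
qed

text \<open>The mirror image: semicontinuity bounds from below, the order of the feet from
  above.\<close>

lemma least_tendsto_right:
  assumes "t > 0"
  shows "((\<lambda>y. least y t) \<longlongrightarrow> least x t) (at_right x)"
proof (rule order_tendstoI)
  let ?S = "least x t"
  fix a assume "a < ?S"
  then have "argmins x t \<subseteq> {a<..}"
    using least_le[OF assms] by fastforce
  then have "\<forall>\<^sub>F y in nhds x. argmins y t \<subseteq> {a<..}"
    by (rule argmins_near[OF assms open_greaterThan])
  then have "\<forall>\<^sub>F y in nhds x. a < least y t"
  proof (rule eventually_mono)
    show "a < least y t" if "argmins y t \<subseteq> {a<..}" for y
      using subsetD[OF that least_in_argmins[OF assms]] by simp
  qed
  then show "\<forall>\<^sub>F y in at_right x. a < least y t"
    by (simp add: eventually_at_filter eventually_mono)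
next
  let ?S = "least x t"
  fix a assume "?S < a"
  then have "((\<lambda>y. t * (g ?S - g a) + y) \<longlongrightarrow> t * (g ?S - g a) + x) (at_right x)" "t * (g ?S - g a) < 0"
    using assms by (auto intro!: tendsto_intros simp: mult_less_0_iff)
  then have "\<forall>\<^sub>F y in at_right x. t * (g ?S - g a) + y < x"
    by (intro order_tendstoD) auto
  moreover have "\<forall>\<^sub>F y in at_right x. x < y"
    by (simp add: eventually_at_filter)
  ultimately show "\<forall>\<^sub>F y in at_right x. least y t < a"
  proof eventually_elim
    case (elim y)
    have "x - t * g ?S \<le> y - t * g (least y t)"
      using elim assms by (intro foot_mono least_in_argmins)
    then have "t * g (least y t) < t * g a"
      using elim by (simp add: algebra_simps)
    then show ?case
      using assms by simp
  qed
qed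

section \<open>The value function as a primitive of the solution, and restarting\<close>

lemma val_lipschitz:
  assumes "t > 0"
  shows "\<bar>val x t - val y t\<bar> \<le> M * \<bar>x - y\<bar>"
proof -
  have *: "val x t - val y t \<le> M * \<bar>x - y\<bar>" for x y
    using val_le_cost[OF assms, of x "least y t"]
      lipschitz[of "x - t * g (least y t)" "y - t * g (least y t)"]
    by (simp add: cost_def val_def[of y])
  show ?thesis
    using *[of x y] *[of y x] by (simp add: abs_le_iff abs_minus_commute)
qed

text \<open>The label \<open>v\<close> joins \<open>y\<close> to the foot of the least minimizer at
  \<open>x\<close>. The terms in \<open>P\<close> then cancel, and the subgradient inequality at
  \<open>v\<close> bounds the difference of the actions.\<close>

lemma val_shift_le:
  assumes "t > 0" "g v = g (least x t) + (y - x) / t"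
  shows "val y t - val x t \<le> v * (y - x)"
proof -
  let ?u = "least x t"
  have yx: "y - x = t * (g v - g ?u)"
    using assms by simp
  then have foot: "y - t * g v = x - t * g ?u"
    by (simp add: algebra_simps)
  have "val y t - val x t \<le> cost v y t - cost ?u x t"
    using val_le_cost[OF assms(1), of y v] by (simp add: val_def[of x])
  also have "\<dots> = t * (G v - G ?u)"
    unfolding cost_def foot by (simp add: algebra_simps)
  also have "\<dots> \<le> t * (v * (g v - g ?u))"
    using subgradient_le[of v ?u] assms(1) by (intro mult_left_mono) (auto simp: algebra_simps)
  also have "\<dots> = v * (y - x)"
    unfolding yx by simp
  finally show ?thesis .
qed

text \<open>Shifting from \<open>x\<close> to \<open>y\<close> and from \<open>y\<close> to
  \<open>x\<close> bounds the increment by \<open>v * (y - x)\<close> from above and by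
  \<open>v' * (y - x)\<close> from below; continuity of \<open>least\<close> brings both labels
  close to \<open>least x t\<close>.\<close>

lemma val_has_derivative:
  assumes "t > 0" "isCont (\<lambda>y. least y t) x"
  shows "((\<lambda>y. val y t) has_real_derivative least x t) (at x)"
  unfolding has_field_derivative_iff
proof (rule tendstoI)
  fix e :: real
  assume "e > 0"
  define u where "u = least x t"
  \<comment> \<open>The labels are confined to a closed interval of radius \<open>d\<close>; halving
    \<open>e\<close> restores the strict inequality.\<close>
  define d where "d = e / 2"
  have d: "0 < d" "d < e"
    using \<open>e > 0\<close> by (auto simp: d_def)
  have lim: "((\<lambda>y. g u + (y - x) / t) \<longlongrightarrow> g u) (at x)"
    using assms by (auto intro!: tendsto_eq_intros)
  have "((\<lambda>y. least y t) \<longlongrightarrow> u) (at x)"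
    using assms(2) by (simp add: u_def isCont_def)
  then have lim': "((\<lambda>y. g (least y t) + (x - y) / t) \<longlongrightarrow> g u) (at x)"
    using assms by (auto intro!: tendsto_eq_intros tendsto_g)
  have gu: "g (u - d) < g u" "g u < g (u + d)"
    using d by auto
  have "\<forall>\<^sub>F y in at x. y \<noteq> x"
    by (simp add: eventually_at_filter)
  then show "\<forall>\<^sub>F y in at x. dist ((val y t - val x t) / (y - x)) (least x t) < e"
    using order_tendstoD(1)[OF lim gu(1)] order_tendstoD(2)[OF lim gu(2)]
      order_tendstoD(1)[OF lim' gu(1)] order_tendstoD(2)[OF lim' gu(2)]
  proof eventually_elim
    case (elim y)
    obtain v where v: "u - d \<le> v" "v \<le> u + d" "g v = g u + (y - x) / t"
      using g_attains[of "u - d" "g u + (y - x) / t" "u + d"] elim by auto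
    obtain v' where v': "u - d \<le> v'" "v' \<le> u + d" "g v' = g (least y t) + (x - y) / t"
      using g_attains[of "u - d" "g (least y t) + (x - y) / t" "u + d"] elim by auto
    have 1: "val y t - val x t \<le> v * (y - x)"
      using val_shift_le[OF assms(1)] v(3) by (simp add: u_def)
    have 2: "v' * (y - x) \<le> val y t - val x t"
      using val_shift_le[OF assms(1) v'(3)] by (simp add: algebra_simps)
    have "u - d \<le> (val y t - val x t) / (y - x) \<and> (val y t - val x t) / (y - x) \<le> u + d"
    proof (cases "x < y")
      case True
      then have "v' \<le> (val y t - val x t) / (y - x)" "(val y t - val x t) / (y - x) \<le> v"
        using 1 2 by (simp_all add: pos_le_divide_eq pos_divide_le_eq)
      then show ?thesis
        using v v' by linarith
    next
      case False
      then have "v \<le> (val y t - val x t) / (y - x)" "(val y t - val x t) / (y - x) \<le> v'"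
        using 1 2 elim by (simp_all add: neg_le_divide_eq neg_divide_le_eq)
      then show ?thesis
        using v v' by linarith
    qed
    then show ?case
      using d by (simp add: u_def dist_real_def abs_if)
  qed
qed

text \<open>The foot \<open>y - t * g (least y t)\<close> is nondecreasing in \<open>y\<close>,
  hence has countably many discontinuities. Where it is continuous, so is \<open>least\<close>,
  because \<open>g\<close> is strictly increasing.\<close>

lemma countable_discont_least:
  assumes "t > 0"
  shows "countable {x. \<not> isCont (\<lambda>y. least y t) x}"
proof -
  have "mono (\<lambda>y. y - t * g (least y t))"
    using foot_mono[OF assms] least_in_argmins[OF assms] by (intro monoI) (metis order_le_less)
  then have "countable {x. \<not> isCont (\<lambda>y. y - t * g (least y t)) x}"
    by (rule mono_ctble_discont)
  moreover have "isCont (\<lambda>y. least y t) x" if "isCont (\<lambda>y. y - t * g (least y t)) x" for x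
  proof -
    have "isCont (\<lambda>y. (y - (y - t * g (least y t))) / t) x"
      by (intro continuous_divide continuous_diff continuous_ident continuous_const that)
        (use assms in auto)
    then have lim: "((\<lambda>y. g (least y t)) \<longlongrightarrow> g (least x t)) (at x)"
      using assms by (simp add: isCont_def)
    show ?thesis
      unfolding isCont_def
    proof (rule order_tendstoI)
      fix a
      show "\<forall>\<^sub>F y in at x. a < least y t" if "a < least x t"
        using order_tendstoD(1)[OF lim, of "g a"] that by simp
      show "\<forall>\<^sub>F y in at x. least y t < a" if "least x t < a"
        using order_tendstoD(2)[OF lim, of "g a"] that by simp
    qed
  qed
  ultimately show ?thesis
    by (auto elim!: countable_subset[rotated])
qed

lemma least_has_integral:
  assumes "t > 0" "a \<le> b"
  shows "((\<lambda>y. least y t) has_integral (val b t - val a t)) {a..b}"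
proof (rule has_integral_lipschitz_ae_derivative[OF _ assms(2) val_lipschitz[OF assms(1)]])
  show "negligible {x. \<not> isCont (\<lambda>y. least y t) x}"
    using countable_discont_least[OF assms(1)]
    by (simp add: negligible_iff_null_sets null_sets_completionI countable_imp_null_set_lborel)
  show "((\<lambda>y. val y t) has_real_derivative least x t) (at x)"
    if "x \<notin> {x. \<not> isCont (\<lambda>y. least y t) x}" for x
    using val_has_derivative[OF assms(1)] that by simp
qed

lemma hopf_lax_val: "t > 0 \<Longrightarrow> hopf_lax g G (\<lambda>y. val y t) M"
  using cont_g subgradient val_lipschitz by unfold_locales auto

text \<open>The path that follows \<open>c\<close> up to time \<open>\<tau>\<close> and
  \<open>c'\<close> afterwards is optimal among all paths to its end point. An optimal path has no
  kink, so \<open>c' = c\<close>, and the straight path from \<open>a\<close> is optimal at time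
  \<open>t\<close>.\<close>

lemma restart_argmins:
  assumes "\<tau> > 0" "\<tau> < t" "argmins (a + \<tau> * g c) \<tau> = {c}"
    and "c' \<in> hopf_lax.argmins g G (\<lambda>y. val y \<tau>) (a + \<tau> * g c + (t - \<tau>) * g c') (t - \<tau>)"
  shows "c \<in> argmins (a + t * g c) t"
proof -
  interpret R: hopf_lax g G "\<lambda>y. val y \<tau>" M
    using assms(1) by (rule hopf_lax_val)
  define x where "x = a + \<tau> * g c + (t - \<tau>) * g c'"
  have "t > 0"
    using assms by simp
  have val: "val (a + \<tau> * g c) \<tau> = P a + \<tau> * G c"
    using val_eq_cost[of \<tau> c "a + \<tau> * g c"] assms by (simp add: cost_def)
  \<comment> \<open>The least minimizer \<open>z\<close> at \<open>(x, t)\<close> competes in the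
    restarted problem; at time \<open>\<tau>\<close> its path passes through
    \<open>x - (t - \<tau>) * g z\<close>, where the value is at most the cost of
    \<open>z\<close>.\<close>
  have ge: "P a + \<tau> * G c + (t - \<tau>) * G c' \<le> val x t"
  proof -
    define z where "z = least x t"
    have "R.cost c' x (t - \<tau>) \<le> R.cost z x (t - \<tau>)"
      using assms(4) by (simp add: R.argmins_def x_def)
    then have "P a + \<tau> * G c + (t - \<tau>) * G c' \<le> val (x - (t - \<tau>) * g z) \<tau> + (t - \<tau>) * G z"
      by (simp add: R.cost_def x_def val)
    also have "\<dots> \<le> cost z (x - (t - \<tau>) * g z) \<tau> + (t - \<tau>) * G z"
      using val_le_cost[OF assms(1)] by simp
    also have "\<dots> = val x t"
      by (simp add: cost_def val_def z_def algebra_simps)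
    finally show ?thesis .
  qed
  have "c' = c"
  proof (rule ccontr)
    assume "c' \<noteq> c"
    then obtain v where v: "t * g v = \<tau> * g c + (t - \<tau>) * g c'" "t * G v < \<tau> * G c + (t - \<tau>) * G c'"
      using junction[of \<tau> "t - \<tau>" c c'] assms by auto
    have "val x t \<le> cost v x t"
      using \<open>t > 0\<close> by (rule val_le_cost)
    moreover have "x - t * g v = a"
      using v by (simp add: x_def)
    ultimately show False
      using ge v by (simp add: cost_def)
  qed
  then have "x = a + t * g c"
    by (simp add: x_def algebra_simps)
  moreover have "cost c x t \<le> val x t"
    using ge \<open>c' = c\<close> \<open>x = a + t * g c\<close> by (simp add: cost_def algebra_simps)
  ultimately show ?thesis
    using val_le_cost[OF \<open>t > 0\<close>] by (auto simp: argmins_def intro: order_trans)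
qed

end

section \<open>Characteristics of the conservation law\<close>

locale convex_flux =
  fixes f :: "real \<Rightarrow> real"
  assumes f_diff: "\<And>x. f differentiable (at x)"
    and f'_diff: "\<And>x. deriv f differentiable (at x)"
    and f''_cont: "continuous_on UNIV (deriv (deriv f))"
    and f''_nonneg: "\<And>x. deriv (deriv f) x \<ge> 0"
    and f''_zeros: "{x. deriv (deriv f) x = 0} \<in> null_sets lebesgue"
begin

text \<open>The Legendre transform of \<open>f\<close>, evaluated at \<open>deriv f u\<close>.\<close>

definition G :: "real \<Rightarrow> real" where
  "G u = u * deriv f u - f u"

lemma f_deriv: "(f has_real_derivative deriv f x) (at x)"
  using f_diff DERIV_deriv_iff_real_differentiable by blast

lemma f'_deriv: "(deriv f has_real_derivative deriv (deriv f) x) (at x)"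
  using f'_diff DERIV_deriv_iff_real_differentiable by blast

text \<open>If the nondecreasing derivative took the same value at \<open>u\<close> and
  \<open>v\<close>, its own derivative would vanish on the interval between them, which is not a
  null set.\<close>

lemma f'_strict_mono: "strict_mono (deriv f)"
proof (rule strict_monoI)
  fix u v :: real
  assume "u < v"
  have mono: "deriv f x \<le> deriv f y" if "x \<le> y" for x y
    using that f'_deriv f''_nonneg by (meson DERIV_nonneg_imp_nondecreasing)
  show "deriv f u < deriv f v"
  proof (rule ccontr)
    assume "\<not> ?thesis"
    then have const: "deriv f x = deriv f u" if "x \<in> {u<..<v}" for x
      using mono[of u x] mono[of x v] that by auto
    have "deriv (deriv f) x = 0" if x: "x \<in> {u<..<v}" for x
    proof -
      have "\<forall>\<^sub>F y in nhds x. deriv f y = deriv f u"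
        using eventually_nhds_in_open[OF open_greaterThanLessThan x] const by (auto elim: eventually_mono)
      then have "(deriv f has_real_derivative deriv (deriv f) x) (at x) \<longleftrightarrow>
        ((\<lambda>_. deriv f u) has_real_derivative deriv (deriv f) x) (at x)"
        by (intro DERIV_cong_ev) auto
      then show ?thesis
        using f'_deriv DERIV_unique[OF _ DERIV_const] by blast
    qed
    then have "{u<..<v} \<in> null_sets lebesgue"
      by (intro null_sets_completion_subset[OF _ f''_zeros]) auto
    then show False
      using \<open>u < v\<close> by (auto simp: null_sets_def)
  qed
qed

text \<open>After cancellation this reads \<open>f v - f u < (v - u) * deriv f v\<close>, which
  follows from the mean value theorem and strict monotonicity of \<open>deriv f\<close>.\<close>

lemma G_subgradient:
  assumes "u \<noteq> v"
  shows "u * (deriv f v - deriv f u) < G v - G u"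
proof -
  have mono: "deriv f x < deriv f y \<longleftrightarrow> x < y" for x y
    using f'_strict_mono by (rule strict_mono_less)
  have "f v - f u < (v - u) * deriv f v"
  proof (cases "u < v")
    case True
    then obtain z where "u < z" "z < v" "f v - f u = (v - u) * deriv f z"
      using MVT2[of u v f "deriv f"] f_deriv by blast
    then show ?thesis
      using mono by simp
  next
    case False
    then have "v < u"
      using assms by simp
    then obtain z where z: "v < z" "z < u" "f u - f v = (u - v) * deriv f z"
      using MVT2[of v u f "deriv f"] f_deriv by blast
    then have "(u - v) * deriv f v < (u - v) * deriv f z"
      using mono by simp
    then show ?thesis
      using z by (simp add: algebra_simps)
  qed
  then show ?thesis
    by (simp add: G_def algebra_simps)
qed

lemma continuous_on_f': "continuous_on UNIV (deriv f)"
  using f'_deriv DERIV_isCont continuous_at_imp_continuous_on by blast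

lemma has_primitive_f'': "has_primitive (deriv (deriv f)) (deriv f)"
  using f'_deriv f''_cont by (rule has_primitive_derivative)

lemma has_primitive_G: "has_primitive (\<lambda>s. s * deriv (deriv f) s) G"
proof (rule has_primitive_derivative)
  show "(G has_real_derivative x * deriv (deriv f) x) (at x)" for x
    unfolding G_def by (auto intro!: derivative_eq_intros f_deriv f'_deriv)
  show "continuous_on UNIV (\<lambda>s. s * deriv (deriv f) s)"
    by (intro continuous_intros f''_cont)
qed

lemma hopf_lax_flux:
  assumes "\<And>a b. \<bar>P a - P b\<bar> \<le> M * \<bar>a - b\<bar>"
  shows "hopf_lax (deriv f) G P M"
  using continuous_on_f' G_subgradient assms by unfold_locales

text \<open>The substitution turns \<open>E\<close> at \<open>u\<close> into
  \<open>cost 0 x t - cost u x t\<close>. The datum \<open>h\<close> is general because both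
  \<open>\<phi>\<close> and the solution at a restart time are inserted.\<close>

lemma maximizers_eq_argmins:
  assumes "has_primitive h H" "\<And>a b. \<bar>H a - H b\<bar> \<le> M * \<bar>a - b\<bar>" "t > 0"
  shows "maximizers f h x t = hopf_lax.argmins (deriv f) G H x t"
proof -
  interpret hopf_lax "deriv f" G H M
    using assms(2) by (rule hopf_lax_flux)
  have "E f h u x t = cost 0 x t - cost u x t" for u
  proof -
    have "has_primitive (\<lambda>s. deriv (deriv f) s * h (x - t * deriv f s) - s * deriv (deriv f) s)
      (\<lambda>s. - H (x - t * deriv f s) / t - G s)"
      by (intro has_primitive_diff has_primitive_substitution has_primitive_G assms f'_strict_mono
          f'_deriv f''_nonneg)
    then have "has_primitive (\<lambda>s. deriv (deriv f) s * (h (x - t * deriv f s) - s))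
      (\<lambda>s. - H (x - t * deriv f s) / t - G s)"
      by (simp add: algebra_simps)
    then show ?thesis
      unfolding E_def LINT_eq_primitive[OF \<open>has_primitive (\<lambda>s. deriv (deriv f) s * _ s) _\<close>]
      using assms(3) by (simp add: cost_def field_simps)
  qed
  then show ?thesis
    by (simp add: maximizers_def argmins_def)
qed

lemma fan_eq: "t > 0 \<Longrightarrow> fan f (t * (deriv f c - deriv f u)) t c = u"
  using strict_mono_imp_inj_on[OF f'_strict_mono] by (simp add: fan_def)

text \<open>For such \<open>l\<close> the fan value is \<open>u\<close>, and
  \<open>(s - c) * deriv (deriv f) s\<close> has the primitive
  \<open>G s - c * deriv f s\<close>.\<close>

lemma F_eq:
  assumes "t > 0" "l = t * (deriv f c - deriv f u)"
  shows "F f l t c = - t * (G u - G c) - c * l"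
proof -
  have "has_primitive (\<lambda>s. c * deriv (deriv f) s) (\<lambda>s. c * deriv f s)"
    using has_primitive_f'' by (auto simp: has_primitive_def simp flip: right_diff_distrib)
  then have "has_primitive (\<lambda>s. (s - c) * deriv (deriv f) s) (\<lambda>s. G s - c * deriv f s)"
    using has_primitive_diff[OF has_primitive_G] by (simp add: algebra_simps)
  from LINT_eq_primitive[OF this]
  have "F f l t c = - t * ((G u - c * deriv f u) - (G c - c * deriv f c))"
    using assms(1) by (simp add: F_def assms(2) fan_eq)
  then show ?thesis
    by (simp add: assms(2) algebra_simps)
qed

end

locale scalar_law = convex_flux f for f +
  fixes \<phi> P :: "real \<Rightarrow> real" and M :: real
  assumes \<phi>_primitive: "has_primitive \<phi> P"
    and P_lipschitz: "\<And>a b. \<bar>P a - P b\<bar> \<le> M * \<bar>a - b\<bar>"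
begin

sublocale hopf_lax "deriv f" G P M
  using P_lipschitz by (rule hopf_lax_flux)

lemma maximizers_eq: "t > 0 \<Longrightarrow> maximizers f \<phi> x t = argmins x t"
  using \<phi>_primitive P_lipschitz by (rule maximizers_eq_argmins)

lemma entropy_sol_eq: "t > 0 \<Longrightarrow> entropy_sol f \<phi> x t = least x t"
  by (simp add: entropy_sol_def least_def maximizers_eq)

section \<open>Traces, shocks and collisions\<close>

lemma left_trace_eq: "t > 0 \<Longrightarrow> left_trace f \<phi> x t = Sup (argmins x t)"
  by (simp add: left_trace_def entropy_sol_eq least_tendsto_left tendsto_Lim)

lemma right_trace_eq: "t > 0 \<Longrightarrow> right_trace f \<phi> x t = least x t"
  by (simp add: right_trace_def entropy_sol_eq least_tendsto_right tendsto_Lim)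

lemma has_primitive_entropy_sol:
  assumes "\<tau> > 0"
  shows "has_primitive (\<lambda>y. entropy_sol f \<phi> y \<tau>) (\<lambda>y. val y \<tau>)"
  unfolding has_primitive_def entropy_sol_eq[OF assms]
proof (intro allI impI conjI)
  fix a b :: real
  assume "a \<le> b"
  note int = least_has_integral[OF assms this]
  show "(\<lambda>y. least y \<tau>) absolutely_integrable_on {a..b}"
  proof (rule absolutely_integrable_integrable_bound)
    show "norm (least y \<tau>) \<le> M" for y
      using subsetD[OF argmins_bounded[OF assms] least_in_argmins[OF assms], of y] by auto
  qed (use int in auto)
  show "integral {a..b} (\<lambda>y. least y \<tau>) = val b \<tau> - val a \<tau>"
    using int by (rule integral_unique)
qed

lemma maximizers_restart_eq:
  assumes "\<tau> > 0" "\<tau> < t"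
  shows "maximizers_restart f \<phi> \<tau> x t = hopf_lax.argmins (deriv f) G (\<lambda>y. val y \<tau>) x (t - \<tau>)"
proof -
  have "maximizers_restart f \<phi> \<tau> x t = maximizers f (\<lambda>y. entropy_sol f \<phi> y \<tau>) x (t - \<tau>)"
    by (simp add: maximizers_restart_def maximizers_def E_restart_def E_def)
  also have "\<dots> = hopf_lax.argmins (deriv f) G (\<lambda>y. val y \<tau>) x (t - \<tau>)"
    using assms by (intro maximizers_eq_argmins[where M = M] has_primitive_entropy_sol val_lipschitz) auto
  finally show ?thesis .
qed

text \<open>A single minimizer makes the traces agree. Any characteristic leaving the point would
  make \<open>c\<close> a minimizer at some time after \<open>\<tau>\<close>.\<close>

lemma continuous_shock_generation:
  assumes "\<tau> > 0" "argmins (a + \<tau> * deriv f c) \<tau> = {c}"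
    and "\<And>t. t > \<tau> \<Longrightarrow> c \<notin> argmins (a + t * deriv f c) t"
  shows "continuous_shock_generation_point f \<phi> (a + \<tau> * deriv f c) \<tau>"
proof -
  have "c' \<notin> maximizers_restart f \<phi> \<tau> (a + \<tau> * deriv f c + (t - \<tau>) * deriv f c') t"
    if "\<tau> < t" for c' t
    using restart_argmins[OF assms(1) that assms(2)] assms(3)[OF that] maximizers_restart_eq assms(1) that
    by blast
  then show ?thesis
    using assms(1,2)
    by (simp add: continuous_shock_generation_point_def emitting_restart_def left_trace_eq
        right_trace_eq least_def)
qed

lemma shock_traces:
  assumes "t > 0" "u \<in> argmins x t" "w \<in> argmins x t" "u \<noteq> w"
  shows "right_trace f \<phi> x t < left_trace f \<phi> x t"
  using least_le[OF assms(1,2)] least_le[OF assms(1,3)] le_Sup_argmins[OF assms(1,2)]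
    le_Sup_argmins[OF assms(1,3)] assms(1,4) by (simp add: left_trace_eq right_trace_eq)

lemma shock_point:
  assumes "t > 0" "u \<in> argmins x t" "w \<in> argmins x t" "u \<noteq> w"
  shows "discontinuous_shock_generation_point f \<phi> x t \<or> point_of_shocks f \<phi> x t"
proof -
  have "maximizers f \<phi> x t \<subseteq> {right_trace f \<phi> x t..left_trace f \<phi> x t}"
    using assms(1) least_le[OF assms(1)] le_Sup_argmins[OF assms(1)]
    by (auto simp: maximizers_eq left_trace_eq right_trace_eq)
  then show ?thesis
    using shock_traces[OF assms] assms(1)
    by (auto simp: discontinuous_shock_generation_point_def point_of_shocks_def)
qed

text \<open>Continuity in the plane, tested along the horizontal approach from the left, would force
  the largest and the least minimizer to coincide.\<close>

lemma on_shock_argmins: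
  assumes "t > 0" "u \<in> argmins x t" "w \<in> argmins x t" "u \<noteq> w"
  shows "on_shock f \<phi> x t"
proof -
  have "\<not> isCont (\<lambda>(y, s). entropy_sol f \<phi> y s) (x, t)"
  proof
    assume cont: "isCont (\<lambda>(y, s). entropy_sol f \<phi> y s) (x, t)"
    have "((\<lambda>y. (y, t)) \<longlongrightarrow> (x, t)) (at_left x)"
      by (intro tendsto_intros)
    from isCont_tendsto_compose[OF cont this]
    have "((\<lambda>y. least y t) \<longlongrightarrow> least x t) (at_left x)"
      using assms(1) by (simp add: entropy_sol_eq)
    then have "least x t = Sup (argmins x t)"
      using tendsto_unique[OF trivial_limit_at_left_real] least_tendsto_left[OF assms(1)] by blast
    then show False
      using shock_traces[OF assms] assms(1) by (simp add: left_trace_eq right_trace_eq)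
  qed
  then show ?thesis
    using shock_traces[OF assms] assms(1) by (simp add: on_shock_def)
qed

text \<open>The colliding characteristic is the backward line with speed \<open>deriv f w\<close>;
  its foot \<open>b\<close> differs from \<open>a\<close> because \<open>deriv f\<close> is
  injective.\<close>

lemma collision:
  assumes "t > 0" "w \<in> argmins (a + t * deriv f c) t" "w \<noteq> c"
  shows "collision_from_away f \<phi> a c t"
proof -
  define b where "b = a + t * deriv f c - t * deriv f w"
  have bt: "b + t * deriv f w = a + t * deriv f c"
    by (simp add: b_def)
  have "b \<noteq> a"
    using assms(1,3) by (simp add: b_def)
  moreover have "w \<in> emitting f \<phi> b"
    using assms bt by (force simp: emitting_def char_line_def maximizers_eq)
  moreover have "\<forall>(x, s) \<in> char_line f b w. s < t \<longrightarrow> maximizers f \<phi> x s = {w}"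
    using characteristic_argmins[of w b t] assms bt by (auto simp: char_line_def maximizers_eq)
  ultimately show ?thesis
    unfolding collision_from_away_def using assms bt by (auto simp: maximizers_eq)
qed

lemma no_collision:
  assumes "t > 0" "argmins (a + t * deriv f c) t = {c}"
  shows "\<not> collision_from_away f \<phi> a c t"
  using assms by (auto simp: collision_from_away_def maximizers_eq)

section \<open>Comparing \<open>Phi\<close> with \<open>F\<close>\<close>

lemma Phi_eq: "Phi \<phi> l a c = P (a + l) - P a - c * l"
proof -
  have "has_primitive (\<lambda>_. c) (\<lambda>x. c * x)"
    by (rule has_primitive_derivative) (auto intro!: derivative_eq_intros)
  then show ?thesis
    by (simp add: Phi_def LINT_eq_primitive[OF has_primitive_diff[OF \<phi>_primitive]] algebra_simps)
qed

text \<open>The terms \<open>c * l\<close> cancel and \<open>a + l\<close> is the foot of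
  \<open>u\<close>, so comparing \<open>Phi\<close> with \<open>F\<close> at \<open>l\<close> is
  comparing the competitor \<open>u\<close> with \<open>c\<close>.\<close>

lemma Phi_minus_F:
  assumes "t > 0" "l = t * (deriv f c - deriv f u)"
  shows "Phi \<phi> l a c - F f l t c = cost u (a + t * deriv f c) t - cost c (a + t * deriv f c) t"
  using F_eq[OF assms] by (simp add: Phi_eq cost_def assms(2) algebra_simps)

text \<open>For fixed \<open>l\<close>, following \<open>u\<close> up to time \<open>s\<close> and
  \<open>c\<close> up to time \<open>t\<close> is a kinked path whose foot is displaced by
  \<open>l\<close>; the straight path \<open>v\<close> with this displacement has strictly smaller
  action.\<close>

lemma F_strict_mono:
  assumes "0 < s" "s < t" "l = s * (deriv f c - deriv f u)" "u \<noteq> c"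
  shows "F f l s c < F f l t c"
proof -
  obtain v where v: "t * deriv f v = s * deriv f u + (t - s) * deriv f c"
    "t * G v < s * G u + (t - s) * G c"
    using junction[of s "t - s" u c] assms by auto
  have "l = t * (deriv f c - deriv f v)"
    using v assms(3) by (simp add: algebra_simps)
  then show ?thesis
    using F_eq[OF assms(1,3)] F_eq[of t l c v] assms(1,2) v(2) by (simp add: algebra_simps)
qed

text \<open>For small \<open>l\<close> the slope \<open>deriv f c - l / t\<close> lies between the
  values of \<open>deriv f\<close> at \<open>c - 1\<close> and \<open>c + 1\<close>, hence in its
  range; \<open>l\<close> being nonzero gives \<open>u \<noteq> c\<close>.\<close>

lemma eventually_admissible:
  assumes "t > 0"
  shows "\<forall>\<^sub>F l in at 0. \<exists>u. l = t * (deriv f c - deriv f u) \<and> u \<noteq> c"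
proof -
  have lim: "((\<lambda>l. deriv f c - l / t) \<longlongrightarrow> deriv f c) (at 0)"
    using assms by (auto intro!: tendsto_eq_intros)
  have "\<forall>\<^sub>F l in at 0. deriv f (c - 1) < deriv f c - l / t" "\<forall>\<^sub>F l in at 0. deriv f c - l / t < deriv f (c + 1)"
    by (intro order_tendstoD[OF lim]; simp)+
  moreover have "\<forall>\<^sub>F l in at (0::real). l \<noteq> 0"
    by (simp add: eventually_at_filter)
  ultimately show ?thesis
  proof eventually_elim
    case (elim l)
    obtain u where "deriv f u = deriv f c - l / t"
      using g_attains[of "c - 1" "deriv f c - l / t" "c + 1"] elim by auto
    then have "l = t * (deriv f c - deriv f u)"
      using assms by (simp add: field_simps)
    then show ?case
      using elim by auto
  qed
qed

lemma eventually_F_less: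
  assumes "0 < s" "s < t"
  shows "\<forall>\<^sub>F l in at 0. F f l s c < F f l t c"
  using eventually_admissible[OF assms(1), of c]
  by eventually_elim (use F_strict_mono assms in blast)

section \<open>The lifespan and its upper bound\<close>

lemma less_lifespanD:
  assumes "0 < t" "ereal t < lifespan f \<phi> a c"
  shows "argmins (a + t * deriv f c) t = {c}"
proof -
  obtain s where "t < s" "c \<in> argmins (a + s * deriv f c) s"
    using assms by (auto simp: lifespan_def less_Sup_iff maximizers_eq)
  then show ?thesis
    using characteristic_argmins assms(1) by blast
qed

lemma le_lifespan:
  assumes "0 < t" "c \<in> argmins (a + t * deriv f c) t"
  shows "ereal t \<le> lifespan f \<phi> a c"
  unfolding lifespan_def using assms by (intro Sup_upper) (auto simp: maximizers_eq)

text \<open>The supremum is attained: \<open>c\<close> is a minimizer at all earlier positive times,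
  and the graph of the minimizers is closed.\<close>

lemma lifespan_in_argmins:
  assumes "lifespan f \<phi> a c = ereal T" "0 < T"
  shows "c \<in> argmins (a + T * deriv f c) T"
proof (rule argmins_closed_graph[OF trivial_limit_at_left_real[of T]])
  show "((\<lambda>t. a + t * deriv f c) \<longlongrightarrow> a + T * deriv f c) (at_left T)"
    by (intro tendsto_intros)
  have "\<forall>\<^sub>F t in at_left T. 0 < t" "\<forall>\<^sub>F t in at_left T. t < T"
    using eventually_at_left_real[OF assms(2)] by (auto elim: eventually_mono)
  then show "\<forall>\<^sub>F t in at_left T. c \<in> argmins (a + t * deriv f c) t"
  proof eventually_elim
    case (elim t)
    then show ?case
      using less_lifespanD[of t a c] assms(1) by simp
  qed
qed (rule tendsto_const, rule tendsto_ident_at)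

lemma terminates_at_lifespan:
  assumes "lifespan f \<phi> a c = ereal T"
  shows "terminates_at f \<phi> a c T"
proof -
  have "t \<le> T" if "0 < t" "c \<in> argmins (a + t * deriv f c) t" for t
    using le_lifespan[OF that] assms by simp
  then show ?thesis
    using less_lifespanD[of _ a c] assms
    by (force simp: terminates_at_def char_line_def maximizers_eq)
qed

lemma exists_for_all_time_lifespan:
  assumes "lifespan f \<phi> a c = \<infinity>"
  shows "exists_for_all_time f \<phi> a c"
  using less_lifespanD[of _ a c] assms
  by (auto simp: exists_for_all_time_def char_line_def maximizers_eq)

lemma eventually_F_less_Phi:
  assumes "0 < t" "ereal t < lifespan f \<phi> a c"
  shows "\<forall>\<^sub>F l in at 0. F f l t c < Phi \<phi> l a c"
  using eventually_admissible[OF assms(1), of c]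
proof eventually_elim
  case (elim l)
  then obtain u where u: "l = t * (deriv f c - deriv f u)" "u \<noteq> c"
    by blast
  have "u \<notin> argmins (a + t * deriv f c) t" "c \<in> argmins (a + t * deriv f c) t"
    using less_lifespanD[OF assms] u(2) by auto
  then have "cost c (a + t * deriv f c) t < cost u (a + t * deriv f c) t"
    by (auto simp: argmins_def not_le intro: le_less_trans)
  then show ?case
    using Phi_minus_F[OF assms(1) u(1), of a] by simp
qed

text \<open>Before the end of the lifespan \<open>c\<close> is the only minimizer, so every small
  nonzero \<open>l\<close> satisfies the strict inequality on both sides of
  \<open>0\<close>.\<close>

lemma lifespan_le_bound: "lifespan f \<phi> a c \<le> lifespan_bound f \<phi> a c"
proof (rule dense_le)
  fix y
  assume "y < lifespan f \<phi> a c"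
  then obtain t0 where t0: "0 < t0" "ereal t0 \<le> lifespan f \<phi> a c" "y < ereal t0"
    by (auto simp: lifespan_def less_Sup_iff intro: Sup_upper)
  \<comment> \<open>The maximum with \<open>0\<close> is there because \<open>y\<close> may be
    negative or minus infinity, while the time \<open>t\<close> must be positive.\<close>
  then obtain t where t: "max y 0 < ereal t" "ereal t < ereal t0"
    using ereal_dense2[of "max y 0" "ereal t0"] by auto
  then have "0 < t" "ereal t < lifespan f \<phi> a c"
    using less_le_trans[OF t(2) t0(2)] by auto
  from eventually_F_less_Phi[OF this]
  have "ereal t \<le> lifespan_bound_right f \<phi> a c" "ereal t \<le> lifespan_bound_left f \<phi> a c"
    using \<open>0 < t\<close> unfolding lifespan_bound_right_def lifespan_bound_left_def
    by (auto intro!: Sup_upper simp: eventually_at_split)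
  then show "y \<le> lifespan_bound f \<phi> a c"
    using t(1) by (auto simp: lifespan_bound_def intro: order_trans less_imp_le)
qed

text \<open>At a time \<open>s\<close> strictly between \<open>T\<close> and \<open>t\<close> the
  inequality \<open>F < Phi\<close> fails for arbitrarily small \<open>l\<close>. Strict growth of
  \<open>F\<close> in time turns this failure into a strict violation at \<open>t\<close>.\<close>

lemma local_compression_bound:
  assumes "lifespan_bound f \<phi> a c = ereal T" "0 < T"
  shows "local_compression f \<phi> a c T"
  unfolding local_compression_def
proof (intro allI impI)
  fix t
  assume "T < t"
  then obtain s where s: "T < s" "s < t"
    using dense by blast
  have "\<exists>\<^sub>F l in at 0. \<not> F f l s c < Phi \<phi> l a c"
  proof (rule ccontr)
    assume "\<not> ?thesis"
    then have "\<forall>\<^sub>F l in at 0. F f l s c < Phi \<phi> l a c"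
      by (simp add: not_frequently)
    then have "ereal s \<le> lifespan_bound f \<phi> a c"
      using s(1) assms(2)
      unfolding lifespan_bound_def lifespan_bound_right_def lifespan_bound_left_def
      by (auto intro!: Sup_upper simp: eventually_at_split)
    then show False
      using s assms(1) by simp
  qed
  moreover have "\<forall>\<^sub>F l in at 0. F f l s c < F f l t c"
    using s assms(2) by (intro eventually_F_less) auto
  ultimately have "\<exists>\<^sub>F l in at 0. \<not> F f l s c < Phi \<phi> l a c \<and> F f l s c < F f l t c"
    by (rule frequently_eventually_frequently)
  then show "\<exists>\<^sub>F l in at 0. Phi \<phi> l a c < F f l t c"
    by (rule frequently_elim1) simp
qed

text \<open>The right and the left bound provide different times \<open>r\<close> and
  \<open>s\<close>; since \<open>F\<close> increases in time, both inequalities persist at any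
  common smaller time.\<close>

lemma less_lifespan_boundD:
  assumes "0 < T" "ereal T < lifespan_bound f \<phi> a c"
  obtains t where "T < t" "\<forall>\<^sub>F l in at 0. F f l t c < Phi \<phi> l a c"
proof -
  obtain r where r: "T < r" "\<forall>\<^sub>F l in at_right 0. F f l r c < Phi \<phi> l a c"
    using assms by (auto simp: lifespan_bound_def lifespan_bound_right_def less_Sup_iff)
  obtain s where s: "T < s" "\<forall>\<^sub>F l in at_left 0. F f l s c < Phi \<phi> l a c"
    using assms by (auto simp: lifespan_bound_def lifespan_bound_left_def less_Sup_iff)
  obtain t where t: "T < t" "t < min r s"
    using dense[of T "min r s"] r s by auto
  have "\<forall>\<^sub>F l in at 0. F f l t c < F f l r c" "\<forall>\<^sub>F l in at 0. F f l t c < F f l s c"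
    using t assms(1) by (auto intro!: eventually_F_less)
  then have "\<forall>\<^sub>F l in at_right 0. F f l t c < F f l r c" "\<forall>\<^sub>F l in at_left 0. F f l t c < F f l s c"
    by (simp_all add: eventually_at_split)
  then have "\<forall>\<^sub>F l in at_right 0. F f l t c < Phi \<phi> l a c" "\<forall>\<^sub>F l in at_left 0. F f l t c < Phi \<phi> l a c"
    using r(2) s(2) by (auto elim: eventually_elim2)
  with that[OF t(1)] show ?thesis
    by (simp add: eventually_at_split)
qed

lemma no_local_compression:
  assumes "0 < T" "ereal T < lifespan_bound f \<phi> a c"
  shows "\<not> local_compression f \<phi> a c T"
proof -
  obtain t where t: "T < t" "\<forall>\<^sub>F l in at 0. F f l t c < Phi \<phi> l a c"
    using less_lifespan_boundD[OF assms] by blast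
  from t(2) have "\<not> (\<exists>\<^sub>F l in at 0. Phi \<phi> l a c < F f l t c)"
    unfolding not_frequently by eventually_elim simp
  with t(1) show ?thesis
    by (auto simp: local_compression_def)
qed

text \<open>
  Just after its lifespan \<open>c\<close> is beaten by some \<open>u\<close>.  By the definition of the bound, the foot of
  \<open>u\<close> stays away from that of \<open>c\<close>, so by semicontinuity \<open>c\<close> is not the only maximizer at the end.
\<close>

lemma lifespan_less_bound:
  assumes "lifespan f \<phi> a c = ereal T" "0 < T" "ereal T < lifespan_bound f \<phi> a c"
  shows "\<exists>u. u \<in> argmins (a + T * deriv f c) T \<and> u \<noteq> c"
proof (rule ccontr)
  obtain t1 where t1: "T < t1" "\<forall>\<^sub>F l in at 0. F f l t1 c < Phi \<phi> l a c"
    using less_lifespan_boundD[OF assms(2,3)] by blast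
  then obtain d where d: "d > 0" "\<And>l. l \<noteq> 0 \<Longrightarrow> \<bar>l\<bar> < d \<Longrightarrow> F f l t1 c < Phi \<phi> l a c"
    unfolding eventually_at by (auto simp: dist_real_def)
  \<comment> \<open>Labels whose feet at time \<open>t1\<close> are displaced by less than
    \<open>d\<close>; for times between \<open>T\<close> and \<open>t1\<close> the displacement is
    smaller still.\<close>
  define S where "S = {u. t1 * \<bar>deriv f c - deriv f u\<bar> < d}"
  assume "\<not> ?thesis"
  then have "argmins (a + T * deriv f c) T \<subseteq> S"
    using d(1) by (auto simp: S_def)
  moreover have "open S"
    unfolding S_def by (intro open_Collect_less continuous_intros cont_g)
  ultimately have "\<forall>\<^sub>F z in nhds (a + T * deriv f c, T). argmins (fst z) (snd z) \<subseteq> S"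
    using assms(2) by (intro argmins_upper_semicontinuous)
  moreover have "((\<lambda>t. (a + t * deriv f c, t)) \<longlongrightarrow> (a + T * deriv f c, T)) (at_right T)"
    by (intro tendsto_intros)
  ultimately have "\<forall>\<^sub>F t in at_right T. argmins (a + t * deriv f c) t \<subseteq> S"
    unfolding filterlim_iff by fastforce
  moreover have "\<forall>\<^sub>F t in at_right T. t \<in> {T<..<t1}"
    using t1(1) by (rule eventually_at_right_real)
  ultimately have "\<forall>\<^sub>F t in at_right T. argmins (a + t * deriv f c) t \<subseteq> S \<and> t \<in> {T<..<t1}"
    by (rule eventually_conj)
  then obtain t where t: "argmins (a + t * deriv f c) t \<subseteq> S" "T < t" "t < t1"
    using eventually_happens'[OF trivial_limit_at_right_real] by fastforce
  then have "t > 0"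
    using assms(2) by simp
  define u where "u = least (a + t * deriv f c) t"
  have u: "u \<in> argmins (a + t * deriv f c) t"
    using least_in_argmins[OF \<open>t > 0\<close>] by (simp add: u_def)
  define l where "l = t * (deriv f c - deriv f u)"
  have "u \<noteq> c"
  proof
    assume "u = c"
    then have "ereal t \<le> ereal T"
      using le_lifespan[OF \<open>t > 0\<close>, of c a] u assms(1) by simp
    then show False
      using t(2) by simp
  qed
  have "\<bar>l\<bar> \<le> t1 * \<bar>deriv f c - deriv f u\<bar>"
    using \<open>t > 0\<close> t(3) by (simp add: l_def abs_mult mult_right_mono)
  also have "\<dots> < d"
    using u t(1) by (auto simp: S_def)
  finally have "F f l t1 c < Phi \<phi> l a c"
    using d(2)[of l] \<open>t > 0\<close> \<open>u \<noteq> c\<close> by (simp add: l_def)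
  moreover have "F f l t c < F f l t1 c"
    using F_strict_mono[OF \<open>t > 0\<close> t(3) l_def \<open>u \<noteq> c\<close>] .
  ultimately have "cost c (a + t * deriv f c) t < cost u (a + t * deriv f c) t"
    using Phi_minus_F[OF \<open>t > 0\<close> l_def, of a] by simp
  then show False
    using u by (auto simp: argmins_def not_le[symmetric])
qed

end

theorem theorem3p14:
  fixes f \<phi> :: "real \<Rightarrow> real" and x\<^sub>0 c :: real
  assumes f_diff: "\<And>x. f differentiable (at x)"
    and f'_diff: "\<And>x. deriv f differentiable (at x)"
    and f''_cont: "continuous_on UNIV (deriv (deriv f))"
    and f''_nonneg: "\<And>x. deriv (deriv f) x \<ge> 0"
    and f''_zeros: "{x. deriv (deriv f) x = 0} \<in> null_sets lebesgue"
    and \<phi>_Linfty: "\<phi> \<in> Linfty"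
    and c_emitting: "c \<in> emitting f \<phi> x\<^sub>0"
  shows
    "let tp = lifespan_bound f \<phi> x\<^sub>0 c; ts = lifespan f \<phi> x\<^sub>0 c;
         Tp = real_of_ereal tp; Ts = real_of_ereal ts;
         xp = x\<^sub>0 + Tp * deriv f c; xs = x\<^sub>0 + Ts * deriv f c;
         case_i = (ts = tp \<and> 0 < tp \<and> tp < \<infinity> \<and> {c} = maximizers f \<phi> xp Tp);
         case_ii = (ts = tp \<and> 0 < tp \<and> tp < \<infinity> \<and> {c} \<subset> maximizers f \<phi> xp Tp);
         case_iii = (ts < tp \<and> 0 < tp \<and> tp \<le> \<infinity>);
         case_iv = (ts = tp \<and> tp = \<infinity>)
     in (case_i \<or> case_ii \<or> case_iii \<or> case_iv) \<and>
        (case_i \<longrightarrow>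
           terminates_at f \<phi> x\<^sub>0 c Tp \<and>
           local_compression f \<phi> x\<^sub>0 c Tp \<and> \<not> collision_from_away f \<phi> x\<^sub>0 c Tp \<and>
           continuous_shock_generation_point f \<phi> xp Tp) \<and>
        (case_ii \<longrightarrow>
           terminates_at f \<phi> x\<^sub>0 c Tp \<and>
           local_compression f \<phi> x\<^sub>0 c Tp \<and> collision_from_away f \<phi> x\<^sub>0 c Tp \<and>
           (discontinuous_shock_generation_point f \<phi> xp Tp \<or> point_of_shocks f \<phi> xp Tp)) \<and>
        (case_iii \<longrightarrow>
           terminates_at f \<phi> x\<^sub>0 c Ts \<and>
           \<not> local_compression f \<phi> x\<^sub>0 c Ts \<and> collision_from_away f \<phi> x\<^sub>0 c Ts \<and>
           {c} \<subset> maximizers f \<phi> xs Ts \<and> on_shock f \<phi> xs Ts) \<and>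
        (case_iv \<longrightarrow> exists_for_all_time f \<phi> x\<^sub>0 c)"
proof -
  interpret convex_flux f
    using f_diff f'_diff f''_cont f''_nonneg f''_zeros by unfold_locales
  obtain P M where "has_primitive \<phi> P" "\<And>a b. \<bar>P a - P b\<bar> \<le> M * \<bar>a - b\<bar>"
    using has_primitive_Linfty[OF \<phi>_Linfty] by blast
  then interpret scalar_law f \<phi> P M
    by unfold_locales
  define tp where "tp = lifespan_bound f \<phi> x\<^sub>0 c"
  define ts where "ts = lifespan f \<phi> x\<^sub>0 c"
  have "ts \<le> tp"
    unfolding ts_def tp_def by (rule lifespan_le_bound)
  obtain t where "0 < t" "c \<in> argmins (x\<^sub>0 + t * deriv f c) t"
    using c_emitting by (auto simp: emitting_def char_line_def maximizers_eq)
  then have "0 < ts"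
    using le_lifespan unfolding ts_def by (metis ereal_less(2) less_le_trans)
  \<comment> \<open>A finite lifespan covers the first three cases: equality with the bound gives
    (i) or (ii), according to whether \<open>c\<close> is the only minimizer at the end, and strict
    inequality gives (iii).\<close>
  have finite_ts: ?thesis if "ts = ereal T" for T
  proof -
    have T: "lifespan f \<phi> x\<^sub>0 c = ereal T" "0 < T"
      using that \<open>0 < ts\<close> by (auto simp: ts_def)
    have c: "c \<in> argmins (x\<^sub>0 + T * deriv f c) T"
      using T by (rule lifespan_in_argmins)
    have after: "c \<notin> argmins (x\<^sub>0 + t * deriv f c) t" if "T < t" for t
      using le_lifespan[of t c x\<^sub>0] that T by auto
    note ends = terminates_at_lifespan[OF T(1)]
    show ?thesis
    proof (cases "tp = ts")
      case True
      then have "lifespan_bound f \<phi> x\<^sub>0 c = ereal T"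
        using T by (simp add: tp_def ts_def)
      note comp = local_compression_bound[OF this T(2)]
      show ?thesis
      proof (cases "argmins (x\<^sub>0 + T * deriv f c) T = {c}")
        case single: True
        show ?thesis
          using continuous_shock_generation[OF T(2) single after] no_collision[OF T(2) single]
            ends comp T single True
          by (simp add: Let_def tp_def ts_def maximizers_eq)
      next
        case False
        with c obtain w where w: "w \<in> argmins (x\<^sub>0 + T * deriv f c) T" "w \<noteq> c"
          by blast
        then have "{c} \<subset> argmins (x\<^sub>0 + T * deriv f c) T"
          using c by auto
        then show ?thesis
          using collision[OF T(2) w] shock_point[OF T(2) w(1) c w(2)] ends comp T True False
          by (simp add: Let_def tp_def ts_def maximizers_eq)
      qed
    next
      case False
      then have less: "ereal T < lifespan_bound f \<phi> x\<^sub>0 c"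
        using \<open>ts \<le> tp\<close> that by (simp add: tp_def ts_def)
      obtain w where w: "w \<in> argmins (x\<^sub>0 + T * deriv f c) T" "w \<noteq> c"
        using lifespan_less_bound[OF T less] by blast
      then have "{c} \<subset> argmins (x\<^sub>0 + T * deriv f c) T"
        using c by auto
      moreover have "0 < lifespan_bound f \<phi> x\<^sub>0 c"
        using less T(2) by (metis ereal_less(2) less_trans)
      ultimately show ?thesis
        using collision[OF T(2) w] on_shock_argmins[OF T(2) w(1) c w(2)] ends
          no_local_compression[OF T(2) less] T less less_imp_neq[OF less]
        by (simp add: Let_def maximizers_eq)
    qed
  qed
  show ?thesis
  proof (cases ts)
    case (real T)
    then show ?thesis
      by (rule finite_ts)
  next
    case PInf
    \<comment> \<open>An infinite lifespan forces an infinite bound, which is case (iv).\<close>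
    then have "tp = \<infinity>"
      using \<open>ts \<le> tp\<close> by simp
    then show ?thesis
      using exists_for_all_time_lifespan[of x\<^sub>0 c] PInf by (simp add: Let_def ts_def tp_def)
  next
    case MInf
    then show ?thesis
      using \<open>0 < ts\<close> by simp
  qed
qed

end
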